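(* Let $\{W(k)\}$ be an independent random model of $m\times m$ stochastic matrices with a common steady state $\pi>0$ in expectation and feedback property. Let $\{F(k)\}$ be a uniform link-failure process that is independent of $\{W(k)\}$, and let $p_k=\Pr(F_{ij}(k)=1)$ (for $i\ne j$). Then the failure model $\{U(k)\}$, given by $$U(k)=W(k)\cdot(ee^T-F(k))+\mathrm{diag}\big([W(k)\cdot F(k)]e\big),$$ is ergodic if and only if $\sum_{k=0}^\infty(1-p_k)\,\mathsf{E}[W_S(k)]=\infty$ for every nonempty proper subset $S\subset[m]$.
   Context: $[m]=\{1,\dots,m\}$. A stochastic matrix is a nonnegative matrix whose rows each sum to $1$. A random model $\{W(k)\}_{k\ge0}$ is a sequence of random $m\times m$ stochastic matrices; it is independent if the matrices $W(k)$ are independent. Here $e\in\mathbb{R}^m$ is the all-ones vector, "$\cdot$" between two matrices is the entrywise product, and $\mathrm{diag}(v)$ is the diagonal matrix with diagonal $v$. For $S\subset[m]$ with complement $\bar S$, $W_S(k)=\sum_{i\in S,\,j\in\bar S}(W_{ij}(k)+W_{ji}(k))$. Common steady state $\pi$ in expectation: $\pi^T\mathsf{E}[W(k)]=\pi^T$ for all $k\ge0$; $\pi>0$ means all entries are positive. Feedback property: there is $\gamma>0$ such that $\mathsf{E}[W_{ii}(k)W_{ij}(k)+W_{jj}(k)W_{ji}(k)]\ge\gamma\,\mathsf{E}[W_{ij}(k)+W_{ji}(k)]$ for all $k\ge0$ and all $i\ne j$ in $[m]$. A uniform link-failure process is a sequence $\{F(k)\}_{k\ge0}$ of random $m\times m$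 matrices with entries in $\{0,1\}$ such that (a) for each fixed $k\ge0$ the random variables $\{F_{ij}(k)\mid i,j\in[m],\,i\ne j\}$ are i.i.d., and (b) the matrices $F(k)$, $k\ge 0$, are independent over time. The distribution may depend on $k$. A deterministic chain $\{A(k)\}$ is ergodic if, for the dynamics $x(k+1)=A(k)x(k)$, $k\ge t_0$, one has $\lim_{k\to\infty}(x_i(k)-x_j(k))=0$ for all $i,j\in[m]$, all $t_0\ge0$ and all $x(t_0)\in\mathbb{R}^m$; a random model is ergodic if this holds almost surely (for almost every realization of the chain). *)

theory Defs
  imports "HOL-Probability.Probability"
begin

definition stochastic_matrix :: "real ^ 'n ^ 'n \<Rightarrow> bool" where
  "stochastic_matrix A \<longleftrightarrow> (\<forall>i j. 0 \<le> A $ i $ j) \<and> (\<forall>i. (\<Sum>j\<in>UNIV. A $ i $ j) = 1)"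

definition random_model :: "'a measure \<Rightarrow> (nat \<Rightarrow> 'a \<Rightarrow> real ^ 'n ^ 'n) \<Rightarrow> bool" where
  "random_model M W \<longleftrightarrow>
     (\<forall>k. W k \<in> borel_measurable M) \<and> (\<forall>k. \<forall>\<omega>\<in>space M. stochastic_matrix (W k \<omega>))"

definition independent_random_model :: "'a measure \<Rightarrow> (nat \<Rightarrow> 'a \<Rightarrow> real ^ 'n ^ 'n) \<Rightarrow> bool" where
  "independent_random_model M W \<longleftrightarrow>
     random_model M W \<and> prob_space.indep_vars M (\<lambda>_. borel) W UNIV"

definition common_steady_state ::
    "'a measure \<Rightarrow> (nat \<Rightarrow> 'a \<Rightarrow> real ^ 'n ^ 'n) \<Rightarrow> real ^ 'n \<Rightarrow> bool" where
  "common_steady_state M W \<pi> \<longleftrightarrow> (\<forall>k. \<pi> v* (\<integral>\<omega>. W k \<omega> \<partial>M) = \<pi>)"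

definition feedback_property :: "'a measure \<Rightarrow> (nat \<Rightarrow> 'a \<Rightarrow> real ^ 'n ^ 'n) \<Rightarrow> bool" where
  "feedback_property M W \<longleftrightarrow>
     (\<exists>\<gamma>>0. \<forall>k i j. i \<noteq> j \<longrightarrow>
        (\<integral>\<omega>. W k \<omega> $ i $ i * W k \<omega> $ i $ j + W k \<omega> $ j $ j * W k \<omega> $ j $ i \<partial>M)
          \<ge> \<gamma> * (\<integral>\<omega>. W k \<omega> $ i $ j + W k \<omega> $ j $ i \<partial>M))"

text \<open>The diagonal entries of a link-failure matrix are unconstrained apart from being 0 or 1.\<close>

definition uniform_link_failure :: "'a measure \<Rightarrow> (nat \<Rightarrow> 'a \<Rightarrow> real ^ 'n ^ 'n) \<Rightarrow> bool" where
  "uniform_link_failure M F \<longleftrightarrow>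
     (\<forall>k. F k \<in> borel_measurable M) \<and>
     (\<forall>k. \<forall>\<omega>\<in>space M. \<forall>i j. F k \<omega> $ i $ j \<in> {0, 1}) \<and>
     (\<forall>k. prob_space.indep_vars M (\<lambda>_. borel) (\<lambda>(i, j) \<omega>. F k \<omega> $ i $ j) {(i, j). i \<noteq> j}) \<and>
     (\<forall>k i j i' j'. i \<noteq> j \<longrightarrow> i' \<noteq> j' \<longrightarrow>
        distr M borel (\<lambda>\<omega>. F k \<omega> $ i $ j) = distr M borel (\<lambda>\<omega>. F k \<omega> $ i' $ j')) \<and>
     prob_space.indep_vars M (\<lambda>_. borel) F UNIV"

text \<open>Independence of the two processes as a whole, i.e. as random elements of the sequence space.\<close>

definition independent_processes ::
    "'a measure \<Rightarrow> (nat \<Rightarrow> 'a \<Rightarrow> real ^ 'n ^ 'n) \<Rightarrow> (nat \<Rightarrow> 'a \<Rightarrow> real ^ 'n ^ 'n) \<Rightarrow> bool" where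
  "independent_processes M W F \<longleftrightarrow>
     prob_space.indep_var M
       (\<Pi>\<^sub>M k\<in>UNIV. borel) (\<lambda>\<omega> k. W k \<omega>)
       (\<Pi>\<^sub>M k\<in>UNIV. borel) (\<lambda>\<omega> k. F k \<omega>)"

definition diag_matrix :: "real ^ 'n \<Rightarrow> real ^ 'n ^ 'n" where
  "diag_matrix v = (\<chi> i j. if i = j then v $ i else 0)"

text \<open>On vectors and matrices, \<open>*\<close> is the entrywise product and \<open>1\<close> has all entries equal to
  one (the matrix product is \<open>**\<close>, the identity matrix \<open>mat 1\<close>).  So the matrix \<open>1\<close> below is
  \<open>e e\<^sup>T\<close> and the vector \<open>1\<close> is \<open>e\<close>.\<close>

definition failure_model ::
    "(nat \<Rightarrow> 'a \<Rightarrow> real ^ 'n ^ 'n) \<Rightarrow> (nat \<Rightarrow> 'a \<Rightarrow> real ^ 'n ^ 'n) \<Rightarrow> nat \<Rightarrow> 'a \<Rightarrow> real ^ 'n ^ 'n" where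
  "failure_model W F k \<omega> =
     W k \<omega> * (1 - F k \<omega>) + diag_matrix ((W k \<omega> * F k \<omega>) *v 1)"

definition ergodic_chain :: "(nat \<Rightarrow> real ^ 'n ^ 'n) \<Rightarrow> bool" where
  "ergodic_chain A \<longleftrightarrow>
     (\<forall>t\<^sub>0 x. (\<forall>k\<ge>t\<^sub>0. x (Suc k) = A k *v x k) \<longrightarrow>
        (\<forall>i j. (\<lambda>k. x k $ i - x k $ j) \<longlonglongrightarrow> 0))"

definition ergodic_model :: "'a measure \<Rightarrow> (nat \<Rightarrow> 'a \<Rightarrow> real ^ 'n ^ 'n) \<Rightarrow> bool" where
  "ergodic_model M W \<longleftrightarrow> (AE \<omega> in M. ergodic_chain (\<lambda>k. W k \<omega>))"

definition flow :: "'n set \<Rightarrow> real ^ 'n ^ 'n \<Rightarrow> real" where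
  "flow S A = (\<Sum>i\<in>S. \<Sum>j\<in>-S. A $ i $ j + A $ j $ i)"

end

theory Submission
  imports Defs
begin

text \<open>For \<open>i \<noteq> j\<close> the expected entries of \<open>U(k)\<close> are those of \<open>W(k)\<close> scaled by \<open>1 - p\<^sub>k\<close>; since link failures
  only increase the diagonal, \<open>U\<close> inherits independence, the steady state and the feedback property
  with the same constant.  So it suffices to show that an independent chain with these properties
  is ergodic iff the expected flow across every nontrivial \<open>S\<close> has a divergent sum.

  If the expected flow across \<open>S\<close> is summable, the flow is almost surely summable, and a trajectory
  started late from the indicator of \<open>S\<close> keeps \<open>S\<close> and its complement apart.  Conversely, divergence
  of the expected flow gives almost sure divergence of the flow by independence.  The energy
  \<open>\<Sum>i. \<pi>\<^sub>i x\<^sub>i\<^sup>2\<close> does not increase in expectation, and by feedback its decrease bounds the disagreement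
  \<open>\<Sum>i j. (U\<^sub>i\<^sub>j + U\<^sub>j\<^sub>i) (x\<^sub>i - x\<^sub>j)\<^sup>2\<close>, which is hence almost surely summable over time.  For a fixed
  realization, these two facts force consensus: a gap between the entries that persists would make
  the flow across it summable.\<close>

section \<open>Trajectories of deterministic chains\<close>

text \<open>The start time is fixed at 0; a later start \<open>t\<close> is expressed by the shifted
  chain \<open>\<lambda>k. A (t + k)\<close>.\<close>

primrec traj :: "(nat \<Rightarrow> real ^ 'n ^ 'n) \<Rightarrow> real ^ 'n \<Rightarrow> nat \<Rightarrow> real ^ 'n" where
  "traj A v 0 = v"
| "traj A v (Suc n) = A n *v traj A v n"

lemma traj_add: "traj A v (m + n) = traj (\<lambda>k. A (m + k)) (traj A v m) n"
  by (induction n) auto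

lemma linear_traj: "linear (\<lambda>v. traj A v n)"
proof (induction n)
  case 0
  show ?case by (simp add: linear_iff)
next
  case (Suc n)
  then show ?case
    by (simp add: linear_iff matrix_vector_right_distrib matrix_vector_mult_scaleR)
qed

lemma traj_basis: "traj A v n $ i = (\<Sum>l\<in>UNIV. v $ l * traj A (axis l 1) n $ i)"
proof -
  have "traj A v n = traj A (\<Sum>l\<in>UNIV. v $ l *\<^sub>R axis l 1) n"
    using basis_expansion[of v] by (simp add: scalar_mult_eq_scaleR)
  also have "\<dots> = (\<Sum>l\<in>UNIV. v $ l *\<^sub>R traj A (axis l 1) n)"
    by (simp add: linear_sum[OF linear_traj] linear_cmul[OF linear_traj])
  finally show ?thesis by (simp add: sum_component)
qed

text \<open>A sequence that obeys the recursion from \<open>t\<close> on is determined from there by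
  its value at \<open>t\<close>, and what precedes \<open>t\<close> does not affect the
  limit.\<close>

lemma ergodic_chain_iff_traj:
  "ergodic_chain A \<longleftrightarrow>
    (\<forall>t v i j. (\<lambda>n. traj (\<lambda>k. A (t + k)) v n $ i - traj (\<lambda>k. A (t + k)) v n $ j) \<longlonglongrightarrow> 0)"
proof (intro iffI allI)
  fix t v i j
  assume A: "ergodic_chain A"
  \<comment> \<open>Truncated subtraction makes the sequence equal to \<open>v\<close> up to time
    \<open>t\<close>; the recursion is required only from \<open>t\<close> on.\<close>
  let ?x = "\<lambda>k. traj (\<lambda>k. A (t + k)) v (k - t)"
  have "?x (Suc k) = A k *v ?x k" if "k \<ge> t" for k
    using that by (simp add: Suc_diff_le)
  then have "(\<lambda>k. ?x k $ i - ?x k $ j) \<longlonglongrightarrow> 0"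
    by (rule A[unfolded ergodic_chain_def, rule_format])
  from LIMSEQ_ignore_initial_segment[OF this, of t]
  show "(\<lambda>n. traj (\<lambda>k. A (t + k)) v n $ i - traj (\<lambda>k. A (t + k)) v n $ j) \<longlonglongrightarrow> 0"
    by simp
next
  assume lim: "\<forall>t v i j. (\<lambda>n. traj (\<lambda>k. A (t + k)) v n $ i - traj (\<lambda>k. A (t + k)) v n $ j) \<longlonglongrightarrow> 0"
  show "ergodic_chain A"
    unfolding ergodic_chain_def
  proof (intro allI impI)
    fix t x i j
    assume x: "\<forall>k\<ge>t. x (Suc k) = A k *v x k"
    have "x (t + n) = traj (\<lambda>k. A (t + k)) (x t) n" for n
      by (induction n) (use x in auto)
    then have "(\<lambda>n. x (n + t) $ i - x (n + t) $ j) \<longlonglongrightarrow> 0"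
      using lim[rule_format, of t "x t" i j] by (simp only: add.commute[of _ t])
    then show "(\<lambda>k. x k $ i - x k $ j) \<longlonglongrightarrow> 0"
      by (rule LIMSEQ_offset)
  qed
qed

text \<open>By linearity the unit vectors suffice as starting points. This leaves countably many
  trajectories, so that almost sure statements about each of them hold simultaneously.\<close>

lemma ergodic_chain_iff_axis:
  "ergodic_chain A \<longleftrightarrow>
    (\<forall>t l i j. (\<lambda>n. traj (\<lambda>k. A (t + k)) (axis l 1) n $ i
                 - traj (\<lambda>k. A (t + k)) (axis l 1) n $ j) \<longlonglongrightarrow> 0)"
  (is "_ \<longleftrightarrow> ?R")
proof
  assume "ergodic_chain A"
  then show ?R by (auto simp: ergodic_chain_iff_traj)
next
  assume R: ?R
  have "(\<lambda>n. traj (\<lambda>k. A (t + k)) v n $ i - traj (\<lambda>k. A (t + k)) v n $ j) \<longlonglongrightarrow> 0" for t v i j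
  proof -
    have "(\<lambda>n. \<Sum>l\<in>UNIV. v $ l * (traj (\<lambda>k. A (t + k)) (axis l 1) n $ i
                 - traj (\<lambda>k. A (t + k)) (axis l 1) n $ j)) \<longlonglongrightarrow> (\<Sum>l\<in>(UNIV::'a set). v $ l * 0)"
      by (intro tendsto_sum tendsto_mult tendsto_const R[rule_format])
    then show ?thesis
      unfolding traj_basis[of _ v] by (simp add: right_diff_distrib sum_subtractf)
  qed
  then show "ergodic_chain A" by (simp add: ergodic_chain_iff_traj)
qed

section \<open>Stochastic matrices and the range of a trajectory\<close>

lemma stochastic_matrix_nonneg: "stochastic_matrix A \<Longrightarrow> 0 \<le> A $ i $ j"
  by (simp add: stochastic_matrix_def)

lemma stochastic_matrix_le_1: "stochastic_matrix A \<Longrightarrow> A $ i $ j \<le> 1"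
  unfolding stochastic_matrix_def
  by (metis UNIV_I finite member_le_sum)

lemma stochastic_mult_bounds:
  assumes "stochastic_matrix A" and "\<And>i. a \<le> x $ i \<and> x $ i \<le> b"
  shows "a \<le> (A *v x) $ i \<and> (A *v x) $ i \<le> b"
proof -
  have one: "(\<Sum>j\<in>UNIV. A $ i $ j) = 1"
    using assms(1) by (simp add: stochastic_matrix_def)
  have "(\<Sum>j\<in>UNIV. A $ i $ j * a) \<le> (A *v x) $ i" "(A *v x) $ i \<le> (\<Sum>j\<in>UNIV. A $ i $ j * b)"
    using assms by (auto simp: matrix_vector_mult_def stochastic_matrix_def intro!: sum_mono mult_left_mono)
  then show ?thesis
    by (simp add: one flip: sum_distrib_right)
qed

lemma traj_bounds:
  assumes "\<And>k. stochastic_matrix (A k)" and "\<And>i. a \<le> v $ i \<and> v $ i \<le> b"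
  shows "a \<le> traj A v n $ i \<and> traj A v n $ i \<le> b"
proof (induction n arbitrary: i)
  case (Suc n)
  then show ?case
    using stochastic_mult_bounds[OF assms(1), of a "traj A v n" b n i] by simp
qed (simp add: assms)

lemma traj_axis_bounds:
  assumes "\<And>k. stochastic_matrix (A k)"
  shows "0 \<le> traj A (axis l 1) n $ i \<and> traj A (axis l 1) n $ i \<le> 1"
  by (rule traj_bounds[OF assms]) (simp add: axis_def)

section \<open>Flow across a cut and the drift that it allows\<close>

lemma flow_Compl: "flow (- S) A = flow S A"
  unfolding flow_def by (subst sum.swap) (simp add: add.commute)

lemma flow_nonneg: "stochastic_matrix A \<Longrightarrow> 0 \<le> flow S A"
  unfolding flow_def by (intro sum_nonneg add_nonneg_nonneg stochastic_matrix_nonneg)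

lemma row_le_flow:
  assumes "stochastic_matrix A" "i \<in> S"
  shows "(\<Sum>j\<in>-S. A $ i $ j) \<le> flow S A"
proof -
  have "(\<Sum>j\<in>-S. A $ i $ j) \<le> (\<Sum>j\<in>-S. A $ i $ j + A $ j $ i)"
    by (intro sum_mono) (simp add: assms stochastic_matrix_nonneg)
  also have "\<dots> \<le> flow S A"
    unfolding flow_def
    by (rule member_le_sum[OF assms(2)])
      (auto intro!: sum_nonneg add_nonneg_nonneg stochastic_matrix_nonneg assms)
  finally show ?thesis .
qed

text \<open>In one step an entry in \<open>S\<close> is pulled down only by the weight that its row
  gives to \<open>- S\<close>. This weight is at most the flow across \<open>S\<close>, and each
  unit of it costs at most the range \<open>b - a\<close>. The losses add up over time.\<close>

lemma traj_drift_lower: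
  assumes st: "\<And>k. stochastic_matrix (A k)"
    and v: "\<And>i. a \<le> v $ i \<and> v $ i \<le> b"
    and u: "\<And>i. i \<in> S \<Longrightarrow> u \<le> v $ i" and "i \<in> S"
  shows "u - (b - a) * (\<Sum>k<n. flow S (A k)) \<le> traj A v n $ i"
  using \<open>i \<in> S\<close>
proof (induction n arbitrary: i)
  case 0
  then show ?case by (simp add: u)
next
  case (Suc n)
  let ?x = "traj A v n" and ?s = "\<Sum>j\<in>-S. A n $ i $ j"
  \<comment> \<open>The bound that the induction hypothesis gives for entries in \<open>S\<close>;
    for entries outside \<open>S\<close> only the lower bound \<open>a\<close> is available.\<close>
  define c where "c = u - (b - a) * (\<Sum>k<n. flow S (A k))"
  have bd: "a \<le> ?x $ j \<and> ?x $ j \<le> b" for j by (rule traj_bounds[OF st v])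
  have c: "c \<le> ?x $ j" if "j \<in> S" for j
    using Suc.IH[OF that] by (simp add: c_def)
  have cb: "c \<le> b" using c[OF Suc.prems] bd[of i] by linarith
  have nn: "0 \<le> A n $ i $ j" for j using st by (rule stochastic_matrix_nonneg)
  have "(\<Sum>j\<in>UNIV. A n $ i $ j) = 1"
    using st by (simp add: stochastic_matrix_def)
  then have one: "(\<Sum>j\<in>S. A n $ i $ j) = 1 - ?s"
    by (subst (asm) sum.subset_diff[of S]) (auto simp: Compl_eq_Diff_UNIV)
  have "(b - a) * ?s \<le> (b - a) * flow S (A n)"
    by (intro mult_left_mono row_le_flow st Suc.prems) (use bd[of i] in linarith)
  moreover have "(c - a) * ?s \<le> (b - a) * ?s"
    by (intro mult_right_mono sum_nonneg nn) (use cb in simp)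
  ultimately have "c - (b - a) * flow S (A n) \<le> c - (c - a) * ?s"
    by linarith
  also have "\<dots> = (\<Sum>j\<in>S. A n $ i $ j) * c + ?s * a"
    by (simp add: one algebra_simps)
  also have "\<dots> = (\<Sum>j\<in>S. A n $ i $ j * c) + (\<Sum>j\<in>-S. A n $ i $ j * a)"
    by (simp add: sum_distrib_right)
  also have "\<dots> \<le> (\<Sum>j\<in>S. A n $ i $ j * ?x $ j) + (\<Sum>j\<in>-S. A n $ i $ j * ?x $ j)"
    by (intro add_mono sum_mono mult_left_mono nn c) (use bd in auto)
  also have "\<dots> = (\<Sum>j\<in>UNIV. A n $ i $ j * ?x $ j)"
    by (subst (3) sum.subset_diff[of S]) (auto simp: Compl_eq_Diff_UNIV)
  also have "\<dots> = traj A v (Suc n) $ i"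
    by (simp add: matrix_vector_mult_def)
  finally show ?case by (simp add: c_def algebra_simps)
qed

text \<open>Negation turns this into the lower bound for \<open>- S\<close>, across which the flow
  is the same.\<close>

lemma traj_drift_upper:
  assumes st: "\<And>k. stochastic_matrix (A k)"
    and v: "\<And>i. a \<le> v $ i \<and> v $ i \<le> b"
    and u: "\<And>i. i \<notin> S \<Longrightarrow> v $ i \<le> u" and "i \<notin> S"
  shows "traj A v n $ i \<le> u + (b - a) * (\<Sum>k<n. flow S (A k))"
proof -
  have "traj A (- v) n = - traj A v n"
    by (rule linear_neg[OF linear_traj])
  then show ?thesis
    using traj_drift_lower[of A "- b" "- v" "- a" "- S" "- u" i n] assms
    by (simp add: flow_Compl add.commute)
qed

lemma not_ergodic_chain_if_summable_flow:
  assumes st: "\<And>k. stochastic_matrix (A k)" and S: "S \<noteq> {}" "S \<noteq> UNIV"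
    and sm: "summable (\<lambda>k. flow S (A k))"
  shows "\<not> ergodic_chain A"
proof
  assume "ergodic_chain A"
  obtain i j where ij: "i \<in> S" "j \<notin> S" using S by blast
  \<comment> \<open>From \<open>t\<close> on, the total flow across \<open>S\<close> stays below
    1/4. The two groups of entries, started at 1 and at 0, each drift by less than that and remain
    at least 1/2 apart.\<close>
  obtain t where t: "\<And>m n. m \<ge> t \<Longrightarrow> norm (\<Sum>k=m..<n. flow S (A k)) < 1/4"
    using sm[unfolded summable_Cauchy, rule_format, of "1/4"] by auto
  define B where "B = (\<lambda>k. A (t + k))"
  define v :: "real^'a" where "v = (\<chi> i. if i \<in> S then 1 else 0)"
  have "1/2 \<le> traj B v n $ i - traj B v n $ j" for n
  proof -
    let ?F = "\<Sum>k<n. flow S (B k)"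
    have "?F < 1/4"
      using t[of t "t + n"] sum.shift_bounds_nat_ivl[of "\<lambda>k. flow S (A k)" 0 t n]
      by (simp add: B_def atLeast0LessThan add.commute)
    moreover have "1 - (1 - 0) * ?F \<le> traj B v n $ i"
      by (rule traj_drift_lower[OF _ _ _ ij(1)]) (auto simp: v_def B_def st)
    moreover have "traj B v n $ j \<le> 0 + (1 - 0) * ?F"
      by (rule traj_drift_upper[OF _ _ _ ij(2)]) (auto simp: v_def B_def st)
    ultimately show ?thesis by simp
  qed
  moreover have "(\<lambda>n. traj B v n $ i - traj B v n $ j) \<longlonglongrightarrow> 0"
    using \<open>ergodic_chain A\<close> unfolding ergodic_chain_iff_traj B_def by blast
  ultimately have "(1/2::real) \<le> 0"
    by (meson LIMSEQ_le_const)
  then show False by simp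
qed

section \<open>Gaps, disagreement and consensus for a fixed realization\<close>

text \<open>Pigeonhole: the range is cut into as many slots as there are entries; the maximal entry lies
  in none of them, so that some slot is empty.\<close>

lemma ex_gap:
  fixes x :: "real ^ 'n"
  assumes "\<And>i. x $ p \<le> x $ i \<and> x $ i \<le> x $ q" and "e > 0" and "e \<le> x $ q - x $ p"
  obtains S l where "S \<noteq> {}" "S \<noteq> UNIV" "\<And>i. i \<notin> S \<Longrightarrow> x $ i \<le> l"
    "\<And>i. i \<in> S \<Longrightarrow> l + e / CARD('n) \<le> x $ i"
proof -
  define h where "h = e / CARD('n)"
  have h: "h > 0" using assms by (simp add: h_def)
  have eh: "e = h * CARD('n)" by (simp add: h_def)
  \<comment> \<open>The number of the slot of width \<open>h\<close> that contains the entry,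
    counted from 0 at the minimum.\<close>
  define f where "f i = nat \<lfloor>(x $ i - x $ p) / h\<rfloor>" for i
  have f: "r = f i" if "x $ p + real r * h \<le> x $ i" "x $ i < x $ p + real r * h + h" for r i
  proof -
    have "real r \<le> (x $ i - x $ p) / h" "(x $ i - x $ p) / h < real r + 1"
      using that h by (auto simp: field_simps)
    then have "\<lfloor>(x $ i - x $ p) / h\<rfloor> = int r" by linarith
    then show ?thesis by (simp add: f_def)
  qed
  have "\<not> {..<CARD('n)} \<subseteq> f ` (UNIV - {q})"
  proof
    assume "{..<CARD('n)} \<subseteq> f ` (UNIV - {q})"
    then have "card {..<CARD('n)} \<le> card (f ` (UNIV - {q}))"
      by (intro card_mono) auto
    also have "\<dots> \<le> card (UNIV - {q})" by (rule card_image_le) simp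
    also have "\<dots> < CARD('n)" by (intro psubset_card_mono) auto
    finally show False by simp
  qed
  then obtain r where r: "r < CARD('n)" "r \<notin> f ` (UNIV - {q})" by auto
  define l where "l = x $ p + real r * h"
  \<comment> \<open>Slot \<open>r\<close> is among the first \<open>CARD('n)\<close> slots, which
    together have length \<open>e\<close>; so the maximum is not below its upper end.\<close>
  have q: "l + h \<le> x $ q"
  proof -
    have "real r + 1 \<le> CARD('n)" using r by linarith
    then have "(real r + 1) * h \<le> e" using h by (simp add: eh mult.commute)
    then show ?thesis using assms(3) by (simp add: l_def algebra_simps)
  qed
  have gap: "x $ i < l \<or> l + h \<le> x $ i" for i
  proof (cases "i = q")
    case False
    then show ?thesis using f[of r i] r unfolding l_def by fastforce
  qed (use q in simp)
  have "x $ p < l + h" using h by (auto simp: l_def intro!: add_nonneg_pos)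
  then have "p \<notin> {i. l + h \<le> x $ i}" by simp
  show thesis
  proof (rule that[of "{i. l + h \<le> x $ i}" l])
    show "{i. l + h \<le> x $ i} \<noteq> {}" using q by auto
    show "{i. l + h \<le> x $ i} \<noteq> UNIV" using \<open>p \<notin> _\<close> by auto
    show "x $ i \<le> l" if "i \<notin> {i. l + h \<le> x $ i}" for i
      using gap[of i] that by simp
    show "l + e / CARD('n) \<le> x $ i" if "i \<in> {i. l + h \<le> x $ i}" for i
      using that by (simp add: h_def)
  qed
qed

text \<open>Up to a constant factor, the Dirichlet form of the symmetrized matrix
  \<open>A + transpose A\<close>.\<close>

definition disagreement :: "real ^ 'n ^ 'n \<Rightarrow> real ^ 'n \<Rightarrow> real" where
  "disagreement A x = (\<Sum>i\<in>UNIV. \<Sum>j\<in>UNIV. (A $ i $ j + A $ j $ i) * (x $ i - x $ j)\<^sup>2)"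

lemma disagreement_nonneg: "stochastic_matrix A \<Longrightarrow> 0 \<le> disagreement A x"
  unfolding disagreement_def
  by (intro sum_nonneg mult_nonneg_nonneg add_nonneg_nonneg stochastic_matrix_nonneg) auto

text \<open>Keep only the pairs that cross the cut; each of their squared differences is at least
  \<open>g\<^sup>2\<close>.\<close>

lemma flow_le_disagreement:
  assumes st: "stochastic_matrix A" and "g \<ge> 0"
    and gap: "\<And>i j. i \<in> S \<Longrightarrow> j \<notin> S \<Longrightarrow> g \<le> x $ i - x $ j"
  shows "g\<^sup>2 * flow S A \<le> disagreement A x"
proof -
  have nn: "0 \<le> (A $ i $ j + A $ j $ i) * (x $ i - x $ j)\<^sup>2" for i j
    by (intro mult_nonneg_nonneg add_nonneg_nonneg stochastic_matrix_nonneg st) auto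
  have "g\<^sup>2 * flow S A = (\<Sum>i\<in>S. \<Sum>j\<in>-S. (A $ i $ j + A $ j $ i) * g\<^sup>2)"
    by (simp add: flow_def sum_distrib_left mult.commute)
  also have "\<dots> \<le> (\<Sum>i\<in>S. \<Sum>j\<in>-S. (A $ i $ j + A $ j $ i) * (x $ i - x $ j)\<^sup>2)"
    using gap \<open>g \<ge> 0\<close>
    by (intro sum_mono mult_left_mono power_mono add_nonneg_nonneg stochastic_matrix_nonneg st) auto
  also have "\<dots> \<le> (\<Sum>i\<in>S. \<Sum>j\<in>UNIV. (A $ i $ j + A $ j $ i) * (x $ i - x $ j)\<^sup>2)"
    by (intro sum_mono sum_mono2) (auto simp: nn)
  also have "\<dots> \<le> disagreement A x"
    unfolding disagreement_def by (intro sum_mono2) (auto intro!: sum_nonneg nn)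
  finally show ?thesis .
qed

lemma ex_extremal_entries:
  fixes x :: "real ^ 'n"
  obtains p q where "\<And>i. x $ p \<le> x $ i \<and> x $ i \<le> x $ q"
proof -
  have "Min (range (($) x)) \<in> range (($) x)" "Max (range (($) x)) \<in> range (($) x)"
    by (auto intro!: Min_in Max_in)
  then obtain p q where "Min (range (($) x)) = x $ p" "Max (range (($) x)) = x $ q"
    by blast
  then have "x $ p \<le> x $ i \<and> x $ i \<le> x $ q" for i
    by (metis Max_ge Min_le finite_imageI finite rangeI)
  then show thesis using that by blast
qed

text \<open>If the spread stays above \<open>e\<close>, then at a late time there is a gap between the entries in some
  set \<open>S\<close> and the others.  As long as this gap persists, the disagreement controls the flow across
  \<open>S\<close>; so this flow is too small to close the gap, which persists forever.\<close>

lemma consensus_if_summable_disagreement: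
  fixes A :: "nat \<Rightarrow> real ^ 'n ^ 'n"
  assumes st: "\<And>k. stochastic_matrix (A k)"
    and inf: "\<And>S. S \<noteq> {} \<Longrightarrow> S \<noteq> UNIV \<Longrightarrow> \<not> summable (\<lambda>k. flow S (A k))"
    and sm: "summable (\<lambda>k. disagreement (A k) (traj A v k))"
  shows "(\<lambda>n. traj A v n $ i - traj A v n $ j) \<longlonglongrightarrow> 0"
proof -
  let ?x = "traj A v"
  \<comment> \<open>A small spread at a single time suffices, since the entries never leave an
    interval that contains all of them.\<close>
  have key: "\<exists>N a b. b - a < e \<and> (\<forall>i. a \<le> ?x N $ i \<and> ?x N $ i \<le> b)" if e: "e > 0" for e
  proof (rule ccontr)
    assume H: "\<not> (\<exists>N a b. b - a < e \<and> (\<forall>i. a \<le> ?x N $ i \<and> ?x N $ i \<le> b))"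
    obtain p0 q0 where v: "\<And>i. v $ p0 \<le> v $ i \<and> v $ i \<le> v $ q0"
      using ex_extremal_entries by blast
    \<comment> \<open>The initial spread bounds the spread at all later times and serves as
      \<open>b - a\<close> in the drift bounds.\<close>
    define D where "D = v $ q0 - v $ p0"
    have "D \<ge> e" using H v unfolding D_def by (metis not_le traj.simps(1))
    then have D: "D > 0" using e by simp
    \<comment> \<open>\<open>ex_gap\<close> yields a gap of \<open>2 * g\<close>; half of it will be
      shown to survive.\<close>
    define g where "g = e / CARD('n) / 2"
    have g: "g > 0" using e by (simp add: g_def)
    \<comment> \<open>While a gap \<open>g\<close> persists, dividing the disagreement by
      \<open>g\<^sup>2\<close> bounds the flow by \<open>g / (2 * D)\<close>. By the drift bounds
      each side then moves by at most \<open>g / 2\<close>.\<close>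
    obtain K where K: "\<And>m n. m \<ge> K \<Longrightarrow>
        norm (\<Sum>k=m..<n. disagreement (A k) (?x k)) < g ^ 3 / (2 * D)"
      using sm[unfolded summable_Cauchy, rule_format, of "g ^ 3 / (2 * D)"] g D by auto
    obtain p q where pq: "\<And>i. ?x K $ p \<le> ?x K $ i \<and> ?x K $ i \<le> ?x K $ q"
      using ex_extremal_entries by blast
    have "e \<le> ?x K $ q - ?x K $ p"
      using H pq by (meson not_le)
    then obtain S l where S: "S \<noteq> {}" "S \<noteq> UNIV" and l: "\<And>i. i \<notin> S \<Longrightarrow> ?x K $ i \<le> l"
      and u: "\<And>i. i \<in> S \<Longrightarrow> l + 2 * g \<le> ?x K $ i"
      using ex_gap[OF pq e] unfolding g_def by auto
    define B where "B = (\<lambda>k. A (K + k))"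
    have stB: "stochastic_matrix (B k)" for k by (simp add: B_def st)
    define y where "y = traj B (?x K)"
    have y: "y n = ?x (K + n)" for n by (simp add: y_def B_def traj_add)
    note range = traj_bounds[OF st v]
    have dis: "(\<Sum>k<n. disagreement (B k) (y k)) < g ^ 3 / (2 * D)" for n
      using K[of K "K + n"] sum.shift_bounds_nat_ivl[of "\<lambda>k. disagreement (A k) (?x k)" 0 K n]
      by (simp add: B_def y atLeast0LessThan add.commute)
    have flow: "(\<Sum>k<n. flow S (B k)) \<le> g / (2 * D)"
      if gap: "\<And>k i j. k < n \<Longrightarrow> i \<in> S \<Longrightarrow> j \<notin> S \<Longrightarrow> g \<le> y k $ i - y k $ j" for n
    proof -
      have "g\<^sup>2 * (\<Sum>k<n. flow S (B k)) \<le> (\<Sum>k<n. disagreement (B k) (y k))"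
        unfolding sum_distrib_left
        by (intro sum_mono flow_le_disagreement stB gap) (use g in auto)
      also have "\<dots> \<le> g ^ 3 / (2 * D)" using dis[of n] by simp
      also have "\<dots> = g\<^sup>2 * (g / (2 * D))" by (simp add: power2_eq_square power3_eq_cube)
      finally show ?thesis using g by (simp only: mult_le_cancel_left_pos zero_less_power)
    qed
    \<comment> \<open>Strong induction: the gap at all earlier times bounds the flow up to time
      \<open>n\<close>, so of the \<open>2 * g\<close> at most \<open>g / 2\<close> is lost on each
      side.\<close>
    have gap: "g \<le> y n $ i - y n $ j" if "i \<in> S" "j \<notin> S" for n i j
      using that
    proof (induction n arbitrary: i j rule: less_induct)
      case (less n)
      let ?F = "\<Sum>k<n. flow S (B k)"
      have "?F \<le> g / (2 * D)" using less.IH by (intro flow) auto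
      then have F: "2 * (D * ?F) \<le> g" using D by (simp add: field_simps)
      have "l + 2 * g - D * ?F \<le> y n $ i"
        unfolding y_def D_def by (rule traj_drift_lower[OF stB range u less.prems(1)])
      moreover have "y n $ j \<le> l + D * ?F"
        unfolding y_def D_def by (rule traj_drift_upper[OF stB range l less.prems(2)])
      ultimately show ?case using F by linarith
    qed
    \<comment> \<open>The gap now holds at all times, so the bound \<open>flow\<close> applies to
      every partial sum, against the divergence assumed in \<open>inf\<close>.\<close>
    have "summable (\<lambda>k. flow S (B k))"
      by (rule summableI_nonneg_bounded[OF flow_nonneg[OF stB] flow]) (rule gap)
    then have "summable (\<lambda>k. flow S (A k))"
      unfolding B_def using summable_iff_shift[of "\<lambda>k. flow S (A k)" K] by (simp add: add.commute)
    then show False using inf S by blast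
  qed
  show ?thesis
  proof (rule LIMSEQ_I)
    fix e :: real assume "0 < e"
    from key[OF this] obtain N a b where N: "b - a < e" "\<And>i. a \<le> ?x N $ i \<and> ?x N $ i \<le> b"
      by blast
    have "norm (?x n $ i - ?x n $ j - 0) < e" if "n \<ge> N" for n
    proof -
      have "a \<le> ?x n $ i \<and> ?x n $ i \<le> b" for i
        using traj_bounds[of "\<lambda>k. A (N + k)" a "?x N" b "n - N"] st N(2) that
        by (simp flip: traj_add)
      from this[of i] this[of j] N(1) show ?thesis by auto
    qed
    then show "\<exists>N. \<forall>n\<ge>N. norm (?x n $ i - ?x n $ j - 0) < e" by blast
  qed
qed

section \<open>Independent chains\<close>

text \<open>The partial sums are monotone, so they either are bounded or tend to infinity. This
  links the divergence in the theorem to \<open>summable\<close>.\<close>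

lemma filterlim_sum_at_top_iff:
  fixes f :: "nat \<Rightarrow> real"
  assumes "\<And>k. 0 \<le> f k"
  shows "filterlim (\<lambda>n. \<Sum>k<n. f k) at_top sequentially \<longleftrightarrow> \<not> summable f"
proof
  assume lim: "filterlim (\<lambda>n. \<Sum>k<n. f k) at_top sequentially"
  show "\<not> summable f"
  proof
    assume "summable f"
    then have "(\<Sum>k<n. f k) \<le> suminf f" for n
      by (intro sum_le_suminf) (auto simp: assms)
    moreover obtain n where "suminf f + 1 \<le> (\<Sum>k<n. f k)"
      using lim unfolding filterlim_at_top eventually_sequentially by blast
    ultimately show False by (metis add_le_same_cancel1 not_one_le_zero order_trans)
  qed
next
  assume "\<not> summable f"
  show "filterlim (\<lambda>n. \<Sum>k<n. f k) at_top sequentially"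
    unfolding filterlim_at_top eventually_sequentially
  proof
    fix Z
    obtain N where N: "Z \<le> (\<Sum>k<N. f k)"
      using summableI_nonneg_bounded[of f Z] assms \<open>\<not> summable f\<close> by (metis linear)
    have "Z \<le> (\<Sum>k<n. f k)" if "n \<ge> N" for n
      using N sum_mono2[of "{..<n}" "{..<N}" f] that assms by force
    then show "\<exists>N. \<forall>n\<ge>N. Z \<le> (\<Sum>k<n. f k)" by blast
  qed
qed

section \<open>Almost sure convergence and divergence of random series\<close>

context prob_space
begin

lemma integrable_bounded_on_space:
  fixes f :: "'a \<Rightarrow> 'b :: {banach, second_countable_topology}"
  assumes "f \<in> borel_measurable M" "\<And>\<omega>. \<omega> \<in> space M \<Longrightarrow> norm (f \<omega>) \<le> B"
  shows "integrable M f"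
  using assms by (intro integrable_const_bound[where B = B] AE_I2) auto

text \<open>By monotone convergence the sum has a finite integral, hence is finite almost
  everywhere.\<close>

lemma AE_summable_if_summable_expectation:
  fixes f :: "nat \<Rightarrow> 'a \<Rightarrow> real"
  assumes int: "\<And>k. integrable M (f k)" and nn: "\<And>k \<omega>. \<omega> \<in> space M \<Longrightarrow> 0 \<le> f k \<omega>"
    and sm: "summable (\<lambda>k. expectation (f k))"
  shows "AE \<omega> in M. summable (\<lambda>k. f k \<omega>)"
proof -
  have [measurable]: "f k \<in> borel_measurable M" for k using int by auto
  have "(\<integral>\<^sup>+\<omega>. (\<Sum>k. ennreal (f k \<omega>)) \<partial>M) = (\<Sum>k. \<integral>\<^sup>+\<omega>. ennreal (f k \<omega>) \<partial>M)"
    by (rule nn_integral_suminf) simp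
  also have "\<dots> = (\<Sum>k. ennreal (expectation (f k)))"
    by (intro suminf_cong nn_integral_eq_integral int AE_I2 nn)
  also have "\<dots> \<noteq> \<infinity>"
    unfolding infinity_ennreal_def
    by (intro ennreal_suminf_neq_top[OF sm] integral_nonneg_AE AE_I2 nn)
  finally have "AE \<omega> in M. (\<Sum>k. ennreal (f k \<omega>)) \<noteq> \<infinity>"
    by (intro nn_integral_PInf_AE) auto
  with AE_space show ?thesis
    by eventually_elim (auto intro: summable_suminf_not_top nn)
qed

text \<open>On \<open>[0, B]\<close>, \<open>exp (- x)\<close> lies below
  \<open>1 / (1 + x)\<close>, hence below the affine function \<open>1 - x / (1 + B)\<close>. Its
  expectation involves only the mean, and \<open>1 - y \<le> exp (- y)\<close> restores an
  exponential that can be multiplied over time.\<close>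

lemma expectation_exp_minus_le:
  assumes [measurable]: "X \<in> borel_measurable M"
    and X: "\<And>\<omega>. \<omega> \<in> space M \<Longrightarrow> 0 \<le> X \<omega> \<and> X \<omega> \<le> B" and B: "0 \<le> (B::real)"
  shows "expectation (\<lambda>\<omega>. exp (- X \<omega>)) \<le> exp (- (expectation X / (1 + B)))"
proof -
  have int: "integrable M X"
    by (rule integrable_bounded_on_space[where B = B]) (use X in auto)
  have "expectation (\<lambda>\<omega>. exp (- X \<omega>)) \<le> expectation (\<lambda>\<omega>. 1 - X \<omega> / (1 + B))"
  proof (rule integral_mono)
    show "integrable M (\<lambda>\<omega>. exp (- X \<omega>))"
      by (rule integrable_bounded_on_space[where B = 1]) (use X in auto)
    show "integrable M (\<lambda>\<omega>. 1 - X \<omega> / (1 + B))"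
      using int by simp
    fix \<omega> assume "\<omega> \<in> space M"
    note x = X[OF this]
    have "exp (- X \<omega>) \<le> 1 / (1 + X \<omega>)"
      using exp_ge_add_one_self[of "X \<omega>"] x by (simp add: exp_minus field_simps)
    also have "\<dots> = 1 - X \<omega> / (1 + X \<omega>)"
      using x by (simp add: field_simps)
    also have "\<dots> \<le> 1 - X \<omega> / (1 + B)"
      using x by (intro diff_left_mono divide_left_mono) auto
    finally show "exp (- X \<omega>) \<le> 1 - X \<omega> / (1 + B)" .
  qed
  also have "\<dots> = 1 - expectation X / (1 + B)"
    using int by (simp add: prob_space)
  also have "\<dots> \<le> exp (- (expectation X / (1 + B)))"
    using exp_ge_add_one_self[of "- (expectation X / (1 + B))"] by simp
  finally show ?thesis .
qed

text \<open>By independence, the expectation of \<open>exp (- S\<^sub>n)\<close>, where \<open>S\<^sub>n\<close> is the partial sum, factorizes and tends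
  to zero.\<close>

lemma AE_not_summable_indep:
  fixes X :: "nat \<Rightarrow> 'a \<Rightarrow> real"
  assumes ind: "indep_vars (\<lambda>_. borel) X UNIV"
    and X: "\<And>k \<omega>. \<omega> \<in> space M \<Longrightarrow> 0 \<le> X k \<omega> \<and> X k \<omega> \<le> B"
    and ns: "\<not> summable (\<lambda>k. expectation (X k))"
  shows "AE \<omega> in M. \<not> summable (\<lambda>k. X k \<omega>)"
proof -
  have [measurable]: "X k \<in> borel_measurable M" for k
    using ind by (auto simp: indep_vars_def2)
  have B: "0 \<le> B" using X not_empty by fastforce
  define Z where "Z n \<omega> = exp (- (\<Sum>k<n. X k \<omega>))" for n \<omega>
  have [measurable]: "Z n \<in> borel_measurable M" for n unfolding Z_def by measurable
  have Z1: "Z n \<omega> \<le> 1" if "\<omega> \<in> space M" for n \<omega>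
    using X[OF that] by (simp add: Z_def sum_nonneg)
  have intZ: "integrable M (Z n)" for n
    by (rule integrable_bounded_on_space[where B = 1]) (use Z1 in \<open>auto simp: Z_def\<close>)
  let ?c = "\<lambda>n. exp (- ((\<Sum>k<n. expectation (X k)) / (1 + B)))"
  have le: "expectation (Z n) \<le> ?c n" for n
  proof -
    have "indep_vars (\<lambda>_. borel) (\<lambda>k \<omega>. exp (- X k \<omega>)) {..<n}"
      by (rule indep_vars_compose2[OF indep_vars_subset[OF ind]]) auto
    then have "expectation (\<lambda>\<omega>. \<Prod>k<n. exp (- X k \<omega>)) = (\<Prod>k<n. expectation (\<lambda>\<omega>. exp (- X k \<omega>)))"
      by (rule indep_vars_lebesgue_integral[rotated])
        (auto intro!: integrable_bounded_on_space[where B = 1] simp: X)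
    then have "expectation (Z n) = (\<Prod>k<n. expectation (\<lambda>\<omega>. exp (- X k \<omega>)))"
      unfolding Z_def by (simp only: exp_sum[OF finite_lessThan] flip: sum_negf)
    also have "\<dots> \<le> (\<Prod>k<n. exp (- (expectation (X k) / (1 + B))))"
      by (intro prod_mono conjI expectation_exp_minus_le X B) auto
    also have "\<dots> = ?c n"
      by (simp add: exp_sum[symmetric] sum_negf sum_divide_distrib)
    finally show ?thesis .
  qed
  have "filterlim (\<lambda>n. \<Sum>k<n. expectation (X k)) at_top sequentially"
    using ns X by (subst filterlim_sum_at_top_iff) (auto intro!: integral_nonneg_AE)
  then have "filterlim (\<lambda>n. 1 / (1 + B) * (\<Sum>k<n. expectation (X k))) at_top sequentially"
    using B by (intro filterlim_tendsto_pos_mult_at_top[OF tendsto_const]) auto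
  then have "filterlim (\<lambda>n. - ((\<Sum>k<n. expectation (X k)) / (1 + B))) at_bot sequentially"
    by (simp add: filterlim_uminus_at_bot)
  then have c0: "?c \<longlonglongrightarrow> 0"
    by (rule filterlim_compose[OF exp_at_bot])
  \<comment> \<open>The infimum over the partial sums has an integral below every
    \<open>?c n\<close>, hence vanishes almost everywhere. On a realization with a finite sum it
    would be at least \<open>exp\<close> of minus that sum, which is positive.\<close>
  define L where "L \<omega> = (INF n. ennreal (Z n \<omega>))" for \<omega>
  have [measurable]: "L \<in> borel_measurable M" unfolding L_def by measurable
  have "(\<integral>\<^sup>+\<omega>. L \<omega> \<partial>M) \<le> ennreal (?c n)" for n
  proof -
    have "(\<integral>\<^sup>+\<omega>. L \<omega> \<partial>M) \<le> (\<integral>\<^sup>+\<omega>. ennreal (Z n \<omega>) \<partial>M)"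
      unfolding L_def by (intro nn_integral_mono INF_lower) auto
    also have "\<dots> = ennreal (expectation (Z n))"
      by (intro nn_integral_eq_integral intZ AE_I2) (simp add: Z_def)
    also have "\<dots> \<le> ennreal (?c n)" by (intro ennreal_leI le)
    finally show ?thesis .
  qed
  moreover have "(\<lambda>n. ennreal (?c n)) \<longlonglongrightarrow> ennreal 0"
    by (intro tendsto_ennrealI c0)
  ultimately have "(\<integral>\<^sup>+\<omega>. L \<omega> \<partial>M) \<le> ennreal 0"
    by (intro LIMSEQ_le_const[of _ "ennreal 0"]) auto
  then have "(\<integral>\<^sup>+\<omega>. L \<omega> \<partial>M) = 0" by simp
  then have "AE \<omega> in M. L \<omega> = 0"
    by (subst (asm) nn_integral_0_iff_AE) auto
  with AE_space show ?thesis
  proof eventually_elim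
    case (elim \<omega>)
    show ?case
    proof
      assume "summable (\<lambda>k. X k \<omega>)"
      then have "ennreal (exp (- (\<Sum>k. X k \<omega>))) \<le> L \<omega>"
        unfolding L_def Z_def using X elim
        by (intro INF_greatest ennreal_leI) (auto intro!: sum_le_suminf)
      then show False using elim by (simp add: ennreal_eq_0_iff)
    qed
  qed
qed

end

section \<open>Measurability of entries, flow and trajectories\<close>

lemma borel_measurable_matrix_nth [measurable]:
  "(\<lambda>A::real^'n^'m. A $ i $ j) \<in> borel_measurable borel"
  by (intro borel_measurable_continuous_onI continuous_intros)

lemma borel_measurable_vec_nth' [measurable]:
  "(\<lambda>x::real^'n. x $ i) \<in> borel_measurable borel"
  by (intro borel_measurable_continuous_onI continuous_intros)

lemma borel_measurable_flow [measurable]: "flow S \<in> borel_measurable borel"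
  unfolding flow_def by measurable

lemma traj_cong: "(\<And>k. k < n \<Longrightarrow> A k = B k) \<Longrightarrow> traj A v n = traj B v n"
  by (induction n) auto

text \<open>The trajectory uses only the matrices at times \<open>t\<close> to
  \<open>t + n - 1\<close>. The index set \<open>I\<close> is left open: \<open>UNIV\<close> serves
  for measurability, the exact time window for independence.\<close>

lemma borel_measurable_traj:
  assumes "{t..<t + n} \<subseteq> I"
  shows "(\<lambda>z. traj (\<lambda>k. z (t + k)) v n) \<in> borel_measurable (\<Pi>\<^sub>M k\<in>I. (borel :: (real^'n^'n) measure))"
  using assms
proof (induction n)
  case (Suc n)
  have "continuous_on UNIV (\<lambda>p::(real^'n^'n) \<times> (real^'n). fst p *v snd p)"
    unfolding matrix_vector_mult_def by (intro continuous_intros)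
  moreover have "(\<lambda>z. z (t + n)) \<in> borel_measurable (\<Pi>\<^sub>M k\<in>I. (borel :: (real^'n^'n) measure))"
    using Suc.prems by (intro measurable_component_singleton) auto
  ultimately show ?case
    unfolding traj.simps
    by (rule borel_measurable_continuous_Pair[rotated 2]) (use Suc.IH Suc.prems in \<open>auto simp: subset_eq\<close>)
qed simp

text \<open>The variance identity: row \<open>l\<close> is a probability vector, and the square of a
  mean is the mean of the squares minus the variance, here in its pairwise form.\<close>

lemma square_mult_stochastic:
  assumes "stochastic_matrix A"
  shows "((A *v x) $ l)\<^sup>2 = (\<Sum>j\<in>UNIV. A $ l $ j * (x $ j)\<^sup>2)
    - (\<Sum>i\<in>UNIV. \<Sum>j\<in>UNIV. A $ l $ i * A $ l $ j * (x $ i - x $ j)\<^sup>2) / 2"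
proof -
  let ?a = "\<lambda>j. A $ l $ j"
  have one: "(\<Sum>j\<in>UNIV. ?a j) = 1"
    using assms by (simp add: stochastic_matrix_def)
  have "(\<Sum>i\<in>UNIV. \<Sum>j\<in>UNIV. ?a i * ?a j * (x $ i - x $ j)\<^sup>2)
      = (\<Sum>i\<in>UNIV. \<Sum>j\<in>UNIV. (?a i * (x $ i)\<^sup>2) * ?a j + ?a i * (?a j * (x $ j)\<^sup>2)
          - 2 * ((?a i * x $ i) * (?a j * x $ j)))"
    by (intro sum.cong refl) (simp add: power2_eq_square algebra_simps)
  also have "\<dots> = (\<Sum>i\<in>UNIV. ?a i * (x $ i)\<^sup>2) * (\<Sum>j\<in>UNIV. ?a j)
      + (\<Sum>i\<in>UNIV. ?a i) * (\<Sum>j\<in>UNIV. ?a j * (x $ j)\<^sup>2)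
      - 2 * ((\<Sum>i\<in>UNIV. ?a i * x $ i) * (\<Sum>j\<in>UNIV. ?a j * x $ j))"
    unfolding sum_product unfolding sum.distrib sum_subtractf sum_distrib_left ..
  also have "\<dots> = 2 * (\<Sum>j\<in>UNIV. ?a j * (x $ j)\<^sup>2) - 2 * ((A *v x) $ l)\<^sup>2"
    by (simp add: one matrix_vector_mult_def power2_eq_square)
  finally show ?thesis by (simp add: field_simps)
qed

text \<open>These are the variance terms in which the averaging row is \<open>i\<close> or
  \<open>j\<close> itself, the quantity that the feedback property bounds from below.\<close>

definition self_weighted :: "real ^ 'n ^ 'n \<Rightarrow> real ^ 'n \<Rightarrow> real" where
  "self_weighted A x = (\<Sum>i\<in>UNIV. \<Sum>j\<in>UNIV.
     (A $ i $ i * A $ i $ j + A $ j $ j * A $ j $ i) * (x $ i - x $ j)\<^sup>2)"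

text \<open>Weight the variance identity of row \<open>l\<close> by \<open>\<pi> $ l\<close> and
  sum. For a pair \<open>i\<close>, \<open>j\<close>, only the variance terms of the rows
  \<open>i\<close> and \<open>j\<close> are kept, with weights at least \<open>c\<close>.\<close>

lemma energy_mult_stochastic_le:
  assumes st: "stochastic_matrix A" and c: "0 \<le> c" "\<And>l. c \<le> \<pi> $ l"
  shows "(\<Sum>l\<in>UNIV. \<pi> $ l * ((A *v x) $ l)\<^sup>2)
    \<le> (\<Sum>l\<in>UNIV. \<Sum>j\<in>UNIV. \<pi> $ l * (A $ l $ j * (x $ j)\<^sup>2)) - c / 2 * self_weighted A x"
proof -
  note nn = stochastic_matrix_nonneg[OF st]
  let ?T = "\<lambda>i j l. \<pi> $ l * (A $ l $ i * A $ l $ j * (x $ i - x $ j)\<^sup>2)"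
  have \<pi>: "0 \<le> \<pi> $ l" for l using c order_trans by blast
  have T0: "0 \<le> ?T i j l" for i j l by (simp add: nn \<pi>)
  have "c * ((A $ i $ i * A $ i $ j + A $ j $ j * A $ j $ i) * (x $ i - x $ j)\<^sup>2)
      \<le> (\<Sum>l\<in>UNIV. ?T i j l)" for i j
  proof (cases "i = j")
    case False
    have "c * ((A $ i $ i * A $ i $ j + A $ j $ j * A $ j $ i) * (x $ i - x $ j)\<^sup>2)
        = c * (A $ i $ i * A $ i $ j * (x $ i - x $ j)\<^sup>2) + c * (A $ j $ i * A $ j $ j * (x $ i - x $ j)\<^sup>2)"
      by (simp add: algebra_simps)
    also have "\<dots> \<le> ?T i j i + ?T i j j"
      by (intro add_mono mult_right_mono c mult_nonneg_nonneg nn) auto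
    also have "\<dots> = (\<Sum>l\<in>{i, j}. ?T i j l)" using False by simp
    also have "\<dots> \<le> (\<Sum>l\<in>UNIV. ?T i j l)" by (intro sum_mono2) (auto simp: T0)
    finally show ?thesis .
  qed simp
  then have "c * self_weighted A x \<le> (\<Sum>i\<in>UNIV. \<Sum>j\<in>UNIV. \<Sum>l\<in>UNIV. ?T i j l)"
    unfolding self_weighted_def sum_distrib_left by (intro sum_mono)
  also have "\<dots> = (\<Sum>i\<in>UNIV. \<Sum>l\<in>UNIV. \<Sum>j\<in>UNIV. ?T i j l)"
    by (intro sum.cong refl sum.swap)
  also have "\<dots> = (\<Sum>l\<in>UNIV. \<Sum>i\<in>UNIV. \<Sum>j\<in>UNIV. ?T i j l)"
    by (rule sum.swap)
  finally have "c / 2 * self_weighted A x \<le> (\<Sum>l\<in>UNIV. \<Sum>i\<in>UNIV. \<Sum>j\<in>UNIV. ?T i j l) / 2"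
    by simp
  moreover have "(\<Sum>l\<in>UNIV. \<pi> $ l * ((A *v x) $ l)\<^sup>2)
      = (\<Sum>l\<in>UNIV. \<Sum>j\<in>UNIV. \<pi> $ l * (A $ l $ j * (x $ j)\<^sup>2))
        - (\<Sum>l\<in>UNIV. \<Sum>i\<in>UNIV. \<Sum>j\<in>UNIV. ?T i j l) / 2"
    unfolding square_mult_stochastic[OF st] sum_divide_distrib
    by (simp add: right_diff_distrib sum_subtractf sum_distrib_left)
  ultimately show ?thesis by simp
qed

section \<open>Independent chains: state and current matrix\<close>

locale independent_chain = prob_space M for M :: "'a measure" +
  fixes U :: "nat \<Rightarrow> 'a \<Rightarrow> real ^ 'n ^ 'n"
  assumes independent: "independent_random_model M U"
begin

lemma measurable_U [measurable]: "U k \<in> borel_measurable M"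
  using independent by (simp add: independent_random_model_def random_model_def)

lemma stochastic_U: "\<omega> \<in> space M \<Longrightarrow> stochastic_matrix (U k \<omega>)"
  using independent by (simp add: independent_random_model_def random_model_def)

lemma indep_U: "indep_vars (\<lambda>_. borel) U UNIV"
  using independent by (simp add: independent_random_model_def)

lemma U_nth_bounds:
  assumes "\<omega> \<in> space M"
  shows "0 \<le> U k \<omega> $ i $ j" "U k \<omega> $ i $ j \<le> 1" "\<bar>U k \<omega> $ i $ j\<bar> \<le> 1"
  using stochastic_matrix_nonneg[OF stochastic_U[OF assms]]
    stochastic_matrix_le_1[OF stochastic_U[OF assms]] by auto

lemma integrable_U_nth: "integrable M (\<lambda>\<omega>. U k \<omega> $ i $ j)"
  by (rule integrable_bounded_on_space[where B = 1])
    (auto simp: U_nth_bounds)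

lemma integrable_U_nth_mult: "integrable M (\<lambda>\<omega>. U k \<omega> $ i $ j * U k \<omega> $ i' $ j')"
  by (rule integrable_bounded_on_space[where B = 1])
    (auto simp: U_nth_bounds abs_mult intro!: mult_le_one)

lemma integrable_flow: "integrable M (\<lambda>\<omega>. flow S (U k \<omega>))"
  unfolding flow_def by (intro Bochner_Integration.integrable_sum Bochner_Integration.integrable_add integrable_U_nth)

abbreviation state :: "nat \<Rightarrow> 'n \<Rightarrow> nat \<Rightarrow> 'a \<Rightarrow> real ^ 'n" where
  "state t l n \<omega> \<equiv> traj (\<lambda>k. U (t + k) \<omega>) (axis l 1) n"

lemma state_bounds:
  "\<omega> \<in> space M \<Longrightarrow> 0 \<le> state t l n \<omega> $ i \<and> state t l n \<omega> $ i \<le> 1"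
  by (rule traj_axis_bounds) (rule stochastic_U)

lemma measurable_state [measurable]: "state t l n \<in> borel_measurable M"
proof -
  have "(\<lambda>\<omega> k. U k \<omega>) \<in> M \<rightarrow>\<^sub>M (\<Pi>\<^sub>M k\<in>UNIV. borel)"
    by (intro measurable_PiM_single') auto
  from measurable_compose[OF this borel_measurable_traj[of t n UNIV "axis l 1"]] show ?thesis
    by simp
qed

text \<open>After \<open>n\<close> steps the state depends on the matrices before time
  \<open>t + n\<close> only, so it is independent of the matrix at time
  \<open>t + n\<close>.\<close>

lemma
  fixes f :: "real ^ 'n ^ 'n \<Rightarrow> real" and g :: "real ^ 'n \<Rightarrow> real"
  assumes [measurable]: "f \<in> borel_measurable borel" "g \<in> borel_measurable borel"
    and int: "integrable M (\<lambda>\<omega>. f (U (t + n) \<omega>))" "integrable M (\<lambda>\<omega>. g (state t l n \<omega>))"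
  shows expectation_mult_state: "expectation (\<lambda>\<omega>. f (U (t + n) \<omega>) * g (state t l n \<omega>))
      = expectation (\<lambda>\<omega>. f (U (t + n) \<omega>)) * expectation (\<lambda>\<omega>. g (state t l n \<omega>))"
    and integrable_mult_state: "integrable M (\<lambda>\<omega>. f (U (t + n) \<omega>) * g (state t l n \<omega>))"
proof -
  let ?I = "{t + n}" and ?J = "{t..<t + n}"
  have "indep_var (PiM ?I (\<lambda>_. borel)) (\<lambda>\<omega>. restrict (\<lambda>i. U i \<omega>) ?I)
      (PiM ?J (\<lambda>_. borel)) (\<lambda>\<omega>. restrict (\<lambda>i. U i \<omega>) ?J)"
    by (rule indep_var_restrict[OF indep_U]) auto
  then have "indep_var borel ((\<lambda>z. f (z (t + n))) \<circ> (\<lambda>\<omega>. restrict (\<lambda>i. U i \<omega>) ?I))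
      borel ((\<lambda>z. g (traj (\<lambda>k. z (t + k)) (axis l 1) n)) \<circ> (\<lambda>\<omega>. restrict (\<lambda>i. U i \<omega>) ?J))"
    by (rule indep_var_compose)
      (auto intro!: measurable_compose[OF borel_measurable_traj] measurable_compose[OF measurable_component_singleton])
  moreover have "traj (\<lambda>k. restrict (\<lambda>i. U i \<omega>) ?J (t + k)) (axis l 1) n = state t l n \<omega>" for \<omega>
    by (rule traj_cong) simp
  ultimately have "indep_var borel (\<lambda>\<omega>. f (U (t + n) \<omega>)) borel (\<lambda>\<omega>. g (state t l n \<omega>))"
    by (simp add: comp_def)
  from indep_var_lebesgue_integral[OF this int] indep_var_integrable[OF this int]
  show "expectation (\<lambda>\<omega>. f (U (t + n) \<omega>) * g (state t l n \<omega>))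
      = expectation (\<lambda>\<omega>. f (U (t + n) \<omega>)) * expectation (\<lambda>\<omega>. g (state t l n \<omega>))"
    and "integrable M (\<lambda>\<omega>. f (U (t + n) \<omega>) * g (state t l n \<omega>))" .
qed

lemma not_ergodic_if_summable_expected_flow:
  assumes S: "S \<noteq> {}" "S \<noteq> UNIV" and sm: "summable (\<lambda>k. expectation (\<lambda>\<omega>. flow S (U k \<omega>)))"
  shows "\<not> ergodic_model M U"
proof
  assume "ergodic_model M U"
  then have "AE \<omega> in M. ergodic_chain (\<lambda>k. U k \<omega>)" by (simp add: ergodic_model_def)
  moreover have "AE \<omega> in M. summable (\<lambda>k. flow S (U k \<omega>))"
    by (rule AE_summable_if_summable_expectation[OF integrable_flow _ sm])
      (intro flow_nonneg stochastic_U)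
  ultimately have "AE \<omega> in M. False"
    using AE_space
  proof eventually_elim
    case (elim \<omega>)
    have "\<not> ergodic_chain (\<lambda>k. U k \<omega>)"
      by (rule not_ergodic_chain_if_summable_flow[OF stochastic_U S]) (use elim in auto)
    with elim show False by simp
  qed
  then show False by simp
qed

lemma AE_not_summable_flow:
  assumes "\<not> summable (\<lambda>k. expectation (\<lambda>\<omega>. flow S (U k \<omega>)))"
  shows "AE \<omega> in M. \<not> summable (\<lambda>k. flow S (U k \<omega>))"
proof (rule AE_not_summable_indep[OF _ _ assms])
  show "indep_vars (\<lambda>_. borel) (\<lambda>k \<omega>. flow S (U k \<omega>)) UNIV"
    by (rule indep_vars_compose2[OF indep_U]) simp
  fix k \<omega> assume "\<omega> \<in> space M"
  note st = stochastic_U[OF this, of k]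
  have "flow S (U k \<omega>) \<le> (\<Sum>i\<in>S. \<Sum>j\<in>-S. 1 + 1)"
    unfolding flow_def by (intro sum_mono add_mono stochastic_matrix_le_1 st)
  then show "0 \<le> flow S (U k \<omega>) \<and> flow S (U k \<omega>) \<le> (\<Sum>i\<in>S. \<Sum>j\<in>-S. 1 + 1)"
    using flow_nonneg[OF st] by blast
qed

end

section \<open>Chains with steady state and feedback: expected energy\<close>

locale balanced_chain = independent_chain M U
  for M :: "'a measure" and U :: "nat \<Rightarrow> 'a \<Rightarrow> real ^ 'n ^ 'n" +
  fixes \<pi> :: "real ^ 'n" and \<gamma> :: real
  assumes pos: "\<And>i. 0 < \<pi> $ i" "0 < \<gamma>"
    and steady: "\<And>k j. (\<Sum>l\<in>UNIV. \<pi> $ l * expectation (\<lambda>\<omega>. U k \<omega> $ l $ j)) = \<pi> $ j"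
    and feedback: "\<And>k i j. i \<noteq> j \<Longrightarrow> \<gamma> * expectation (\<lambda>\<omega>. U k \<omega> $ i $ j + U k \<omega> $ j $ i)
      \<le> expectation (\<lambda>\<omega>. U k \<omega> $ i $ i * U k \<omega> $ i $ j + U k \<omega> $ j $ j * U k \<omega> $ j $ i)"
begin

text \<open>An expected quadratic Lyapunov function. The weights \<open>\<pi>\<close> are chosen
  such that averaging preserves it in expectation up to the variance term.\<close>

definition energy :: "nat \<Rightarrow> 'n \<Rightarrow> nat \<Rightarrow> real" where
  "energy t l n = expectation (\<lambda>\<omega>. \<Sum>i\<in>UNIV. \<pi> $ i * (state t l n \<omega> $ i)\<^sup>2)"

lemma integrable_state_square: "integrable M (\<lambda>\<omega>. (state t l n \<omega> $ i)\<^sup>2)"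
  by (rule integrable_bounded_on_space[where B = 1])
    (auto simp: state_bounds power_le_one_iff abs_square_le_1 abs_le_iff intro: order_trans[of _ 0])

lemma integrable_state_diff_square: "integrable M (\<lambda>\<omega>. (state t l n \<omega> $ i - state t l n \<omega> $ j)\<^sup>2)"
proof (rule integrable_bounded_on_space[where B = 1])
  fix \<omega> assume "\<omega> \<in> space M"
  from state_bounds[OF this, of t l n i] state_bounds[OF this, of t l n j]
  have "\<bar>state t l n \<omega> $ i - state t l n \<omega> $ j\<bar> \<le> 1" by linarith
  then show "norm ((state t l n \<omega> $ i - state t l n \<omega> $ j)\<^sup>2) \<le> 1"
    by (simp add: abs_square_le_1)
qed measurable

text \<open>The coefficients are independent of the state, so each product splits. Feedback, which
  speaks of expectations only, can thus be applied term by term.\<close>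

lemma
  fixes f :: "'n \<Rightarrow> 'n \<Rightarrow> real ^ 'n ^ 'n \<Rightarrow> real"
  assumes f: "\<And>i j. f i j \<in> borel_measurable borel" "\<And>i j. integrable M (\<lambda>\<omega>. f i j (U (t + n) \<omega>))"
  shows expectation_quadratic:
    "expectation (\<lambda>\<omega>. \<Sum>i\<in>UNIV. \<Sum>j\<in>UNIV.
        f i j (U (t + n) \<omega>) * (state t l n \<omega> $ i - state t l n \<omega> $ j)\<^sup>2)
      = (\<Sum>i\<in>UNIV. \<Sum>j\<in>UNIV. expectation (\<lambda>\<omega>. f i j (U (t + n) \<omega>))
          * expectation (\<lambda>\<omega>. (state t l n \<omega> $ i - state t l n \<omega> $ j)\<^sup>2))" (is ?E)
    and integrable_quadratic:
    "integrable M (\<lambda>\<omega>. \<Sum>i\<in>UNIV. \<Sum>j\<in>UNIV.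
        f i j (U (t + n) \<omega>) * (state t l n \<omega> $ i - state t l n \<omega> $ j)\<^sup>2)" (is ?I)
proof -
  have m: "(\<lambda>x::real^'n. (x $ i - x $ j)\<^sup>2) \<in> borel_measurable borel" for i j
    by measurable
  note * = expectation_mult_state[OF f(1) m f(2) integrable_state_diff_square]
    integrable_mult_state[OF f(1) m f(2) integrable_state_diff_square]
  show ?E ?I by (simp_all add: *)
qed

lemma integrable_disagreement: "integrable M (\<lambda>\<omega>. disagreement (U (t + n) \<omega>) (state t l n \<omega>))"
  unfolding disagreement_def
  by (rule integrable_quadratic) (auto intro!: integrable_U_nth)

lemma energy_Suc_le:
  assumes c: "0 \<le> c" "\<And>i. c \<le> \<pi> $ i"
  shows "energy t l (Suc n) \<le> energy t l n
    - c * \<gamma> / 2 * expectation (\<lambda>\<omega>. disagreement (U (t + n) \<omega>) (state t l n \<omega>))"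
proof -
  let ?x = "state t l n" and ?U = "U (t + n)"
  let ?q = "\<lambda>i j. expectation (\<lambda>\<omega>. (?x \<omega> $ i - ?x \<omega> $ j)\<^sup>2)"
  have m: "(\<lambda>x::real^'n. (x $ j)\<^sup>2) \<in> borel_measurable borel" for j by measurable
  note sq = expectation_mult_state[OF borel_measurable_matrix_nth m integrable_U_nth integrable_state_square]
    integrable_mult_state[OF borel_measurable_matrix_nth m integrable_U_nth integrable_state_square]
  have intw: "integrable M (\<lambda>\<omega>. self_weighted (?U \<omega>) (?x \<omega>))"
    unfolding self_weighted_def
    by (rule integrable_quadratic) (auto intro!: integrable_U_nth_mult)
  have "energy t l (Suc n) \<le> expectation (\<lambda>\<omega>.
      (\<Sum>i\<in>UNIV. \<Sum>j\<in>UNIV. \<pi> $ i * (?U \<omega> $ i $ j * (?x \<omega> $ j)\<^sup>2)) - c / 2 * self_weighted (?U \<omega>) (?x \<omega>))"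
    unfolding energy_def
  proof (rule integral_mono)
    show "integrable M (\<lambda>\<omega>. \<Sum>i\<in>UNIV. \<pi> $ i * (state t l (Suc n) \<omega> $ i)\<^sup>2)"
      by (intro Bochner_Integration.integrable_sum integrable_mult_right integrable_state_square)
    show "integrable M (\<lambda>\<omega>. (\<Sum>i\<in>UNIV. \<Sum>j\<in>UNIV. \<pi> $ i * (?U \<omega> $ i $ j * (?x \<omega> $ j)\<^sup>2))
        - c / 2 * self_weighted (?U \<omega>) (?x \<omega>))"
      by (intro Bochner_Integration.integrable_diff Bochner_Integration.integrable_sum integrable_mult_right sq intw)
    fix \<omega> assume "\<omega> \<in> space M"
    from energy_mult_stochastic_le[OF stochastic_U[OF this] c]
    show "(\<Sum>i\<in>UNIV. \<pi> $ i * (state t l (Suc n) \<omega> $ i)\<^sup>2)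
      \<le> (\<Sum>i\<in>UNIV. \<Sum>j\<in>UNIV. \<pi> $ i * (?U \<omega> $ i $ j * (?x \<omega> $ j)\<^sup>2)) - c / 2 * self_weighted (?U \<omega>) (?x \<omega>)"
      by simp
  qed
  also have "\<dots> = expectation (\<lambda>\<omega>. \<Sum>i\<in>UNIV. \<Sum>j\<in>UNIV. \<pi> $ i * (?U \<omega> $ i $ j * (?x \<omega> $ j)\<^sup>2))
      - c / 2 * expectation (\<lambda>\<omega>. self_weighted (?U \<omega>) (?x \<omega>))"
    by (subst Bochner_Integration.integral_diff)
      (auto intro!: Bochner_Integration.integrable_sum integrable_mult_right sq intw)
  also have "expectation (\<lambda>\<omega>. \<Sum>i\<in>UNIV. \<Sum>j\<in>UNIV. \<pi> $ i * (?U \<omega> $ i $ j * (?x \<omega> $ j)\<^sup>2))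
      = (\<Sum>i\<in>UNIV. \<Sum>j\<in>UNIV. \<pi> $ i * expectation (\<lambda>\<omega>. ?U \<omega> $ i $ j) * expectation (\<lambda>\<omega>. (?x \<omega> $ j)\<^sup>2))"
    by (simp add: sq mult.assoc)
  \<comment> \<open>Summed over the rows first, the coefficient of the square of entry
    \<open>j\<close> is entry \<open>j\<close> of \<open>\<pi>\<close> times the expected matrix,
    which is \<open>\<pi> $ j\<close> again.\<close>
  also have "\<dots> = (\<Sum>j\<in>UNIV. \<pi> $ j * expectation (\<lambda>\<omega>. (?x \<omega> $ j)\<^sup>2))"
    by (subst sum.swap) (simp add: steady flip: sum_distrib_right)
  also have "\<dots> = energy t l n"
    unfolding energy_def by (simp add: integrable_state_square)
  finally have 1: "energy t l (Suc n) \<le> energy t l n - c / 2 * expectation (\<lambda>\<omega>. self_weighted (?U \<omega>) (?x \<omega>))" .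
  \<comment> \<open>Feedback compares the coefficients of the two quadratic forms pair by pair; the
    terms with \<open>i = j\<close> vanish on both sides.\<close>
  have "\<gamma> * expectation (\<lambda>\<omega>. disagreement (?U \<omega>) (?x \<omega>))
      = (\<Sum>i\<in>UNIV. \<Sum>j\<in>UNIV. \<gamma> * expectation (\<lambda>\<omega>. ?U \<omega> $ i $ j + ?U \<omega> $ j $ i) * ?q i j)"
    unfolding disagreement_def
    by (subst expectation_quadratic)
      (auto intro!: Bochner_Integration.integrable_add integrable_U_nth simp: sum_distrib_left mult.assoc)
  also have "\<dots> \<le> (\<Sum>i\<in>UNIV. \<Sum>j\<in>UNIV. expectation (\<lambda>\<omega>. ?U \<omega> $ i $ i * ?U \<omega> $ i $ j
      + ?U \<omega> $ j $ j * ?U \<omega> $ j $ i) * ?q i j)"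
  proof (intro sum_mono)
    fix i j
    show "\<gamma> * expectation (\<lambda>\<omega>. ?U \<omega> $ i $ j + ?U \<omega> $ j $ i) * ?q i j
      \<le> expectation (\<lambda>\<omega>. ?U \<omega> $ i $ i * ?U \<omega> $ i $ j + ?U \<omega> $ j $ j * ?U \<omega> $ j $ i) * ?q i j"
      by (cases "i = j") (auto intro!: mult_right_mono feedback)
  qed
  also have "\<dots> = expectation (\<lambda>\<omega>. self_weighted (?U \<omega>) (?x \<omega>))"
    unfolding self_weighted_def
    by (subst expectation_quadratic) (auto intro!: Bochner_Integration.integrable_add integrable_U_nth_mult)
  finally have "c / 2 * (\<gamma> * expectation (\<lambda>\<omega>. disagreement (?U \<omega>) (?x \<omega>)))
      \<le> c / 2 * expectation (\<lambda>\<omega>. self_weighted (?U \<omega>) (?x \<omega>))"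
    using c by (intro mult_left_mono) auto
  with 1 show ?thesis by (simp add: mult.assoc)
qed

text \<open>Telescoping: the energy is nonnegative and loses a fixed multiple of the expected
  disagreement in every step.\<close>

lemma AE_summable_disagreement:
  "AE \<omega> in M. summable (\<lambda>n. disagreement (U (t + n) \<omega>) (state t l n \<omega>))"
proof (rule AE_summable_if_summable_expectation[OF integrable_disagreement])
  show "0 \<le> disagreement (U (t + k) \<omega>) (state t l k \<omega>)" if "\<omega> \<in> space M" for k \<omega>
    by (intro disagreement_nonneg stochastic_U that)
  let ?d = "\<lambda>n. expectation (\<lambda>\<omega>. disagreement (U (t + n) \<omega>) (state t l n \<omega>))"
  obtain p q where p: "\<And>i. \<pi> $ p \<le> \<pi> $ i \<and> \<pi> $ i \<le> \<pi> $ q"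
    using ex_extremal_entries[of \<pi>] by blast
  \<comment> \<open>The smallest entry of \<open>\<pi>\<close> is the uniform weight
    \<open>c\<close> of \<open>energy_Suc_le\<close>; it is positive because an entry of
    \<open>\<pi>\<close> attains it.\<close>
  define C where "C = \<pi> $ p * \<gamma> / 2"
  have C: "C > 0" using pos by (simp add: C_def)
  have "C * (\<Sum>k<n. ?d k) \<le> energy t l 0 - energy t l n" for n
  proof (induction n)
    case (Suc n)
    have "energy t l (Suc n) \<le> energy t l n - C * ?d n"
      unfolding C_def by (rule energy_Suc_le) (use p pos[THEN less_imp_le] in auto)
    with Suc show ?case by (simp add: distrib_left)
  qed simp
  moreover have "0 \<le> energy t l n" for n
    unfolding energy_def
    by (intro integral_nonneg_AE AE_I2 sum_nonneg mult_nonneg_nonneg) (auto simp: less_imp_le pos)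
  ultimately have bd: "(\<Sum>k<n. ?d k) \<le> energy t l 0 / C" for n
  proof -
    assume "\<And>n. C * (\<Sum>k<n. ?d k) \<le> energy t l 0 - energy t l n" "\<And>n. 0 \<le> energy t l n"
    from this[of n] have "C * (\<Sum>k<n. ?d k) \<le> energy t l 0" by linarith
    then show ?thesis using C by (simp add: pos_le_divide_eq mult.commute)
  qed
  show "summable ?d"
    by (rule summableI_nonneg_bounded[OF _ bd])
      (auto intro!: integral_nonneg_AE AE_I2 disagreement_nonneg stochastic_U)
qed

theorem ergodic_iff_infinite_expected_flow:
  "ergodic_model M U \<longleftrightarrow>
    (\<forall>S. S \<noteq> {} \<and> S \<noteq> UNIV \<longrightarrow> \<not> summable (\<lambda>k. expectation (\<lambda>\<omega>. flow S (U k \<omega>))))"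
proof (intro iffI allI impI notI)
  fix S :: "'n set"
  assume "ergodic_model M U" "S \<noteq> {} \<and> S \<noteq> UNIV" "summable (\<lambda>k. expectation (\<lambda>\<omega>. flow S (U k \<omega>)))"
  then show False using not_ergodic_if_summable_expected_flow by blast
next
  assume inf: "\<forall>S. S \<noteq> {} \<and> S \<noteq> UNIV \<longrightarrow> \<not> summable (\<lambda>k. expectation (\<lambda>\<omega>. flow S (U k \<omega>)))"
  \<comment> \<open>There are only finitely many \<open>S\<close> and countably many pairs of
    \<open>t\<close> and \<open>l\<close>, so the exceptional null sets can be united.\<close>
  have "AE \<omega> in M. \<forall>S\<in>{S. S \<noteq> {} \<and> S \<noteq> UNIV}. \<not> summable (\<lambda>k. flow S (U k \<omega>))"
    by (intro AE_finite_allI AE_not_summable_flow) (use inf in auto)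
  moreover have "AE \<omega> in M. \<forall>t l. summable (\<lambda>n. disagreement (U (t + n) \<omega>) (state t l n \<omega>))"
    unfolding AE_all_countable by (intro allI AE_summable_disagreement)
  ultimately show "ergodic_model M U"
    unfolding ergodic_model_def using AE_space
  proof eventually_elim
    case (elim \<omega>)
    have "\<not> summable (\<lambda>k. flow S (U (t + k) \<omega>))" if "S \<noteq> {}" "S \<noteq> UNIV" for S t
      using elim(1) that summable_iff_shift[of "\<lambda>k. flow S (U k \<omega>)" t] by (simp add: add.commute)
    then show ?case
      unfolding ergodic_chain_iff_axis
      using elim by (intro allI consensus_if_summable_disagreement stochastic_U) auto
  qed
qed

end

section \<open>Link failures\<close>

text \<open>For measurable rectangles the probability splits first between the two processes, then
  over time within each. Rectangles are stable under intersection and generate the product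
  sigma-algebra, so independence extends to all events.\<close>

lemma (in prob_space) indep_vars_Pair:
  assumes X: "indep_vars (\<lambda>_. N) X I" and Y: "indep_vars (\<lambda>_. N') Y I"
    and XY: "indep_var (\<Pi>\<^sub>M k\<in>I. N) (\<lambda>\<omega>. \<lambda>k\<in>I. X k \<omega>) (\<Pi>\<^sub>M k\<in>I. N') (\<lambda>\<omega>. \<lambda>k\<in>I. Y k \<omega>)"
  shows "indep_vars (\<lambda>_. N \<Otimes>\<^sub>M N') (\<lambda>k \<omega>. (X k \<omega>, Y k \<omega>)) I"
proof -
  have mX: "X k \<in> M \<rightarrow>\<^sub>M N" and mY: "Y k \<in> M \<rightarrow>\<^sub>M N'" if "k \<in> I" for k
    using X Y that by (auto simp: indep_vars_def2)
  let ?R = "\<lambda>k. {(\<lambda>\<omega>. (X k \<omega>, Y k \<omega>)) -` (A \<times> B) \<inter> space M | A B. A \<in> sets N \<and> B \<in> sets N'}"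
  have prob_rect: "prob (\<Inter>k\<in>J. (\<lambda>\<omega>. (X k \<omega>, Y k \<omega>)) -` (a k \<times> b k) \<inter> space M)
      = (\<Prod>k\<in>J. prob (X k -` a k \<inter> space M)) * (\<Prod>k\<in>J. prob (Y k -` b k \<inter> space M))"
    if J: "J \<noteq> {}" "J \<subseteq> I" "finite J" and ab: "\<And>k. k \<in> J \<Longrightarrow> a k \<in> sets N \<and> b k \<in> sets N'" for J a b
  proof -
    let ?X = "\<lambda>\<omega>. \<lambda>k\<in>I. X k \<omega>" and ?Y = "\<lambda>\<omega>. \<lambda>k\<in>I. Y k \<omega>"
    \<comment> \<open>The rectangles at the times in \<open>J\<close> become one product of two
      cylinder events, to which the independence of the whole processes applies.\<close>
    let ?A = "\<Inter>k\<in>J. (\<lambda>z. z k) -` a k \<inter> space (\<Pi>\<^sub>M k\<in>I. N)"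
    let ?B = "\<Inter>k\<in>J. (\<lambda>z. z k) -` b k \<inter> space (\<Pi>\<^sub>M k\<in>I. N')"
    have A: "?A \<in> sets (\<Pi>\<^sub>M k\<in>I. N)" and B: "?B \<in> sets (\<Pi>\<^sub>M k\<in>I. N')"
      by (intro sets.finite_INT measurable_sets[OF measurable_component_singleton];
          use J ab in blast)+
    have X_space: "?X \<omega> \<in> space (\<Pi>\<^sub>M k\<in>I. N)" and Y_space: "?Y \<omega> \<in> space (\<Pi>\<^sub>M k\<in>I. N')"
      if "\<omega> \<in> space M" for \<omega>
      using that by (auto simp: space_PiM intro: measurable_space[OF mX] measurable_space[OF mY])
    have eqs: "(\<Inter>k\<in>J. (\<lambda>\<omega>. (X k \<omega>, Y k \<omega>)) -` (a k \<times> b k) \<inter> space M)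
        = (\<lambda>\<omega>. (?X \<omega>, ?Y \<omega>)) -` (?A \<times> ?B) \<inter> space M"
      "?X -` ?A \<inter> space M = (\<Inter>k\<in>J. X k -` a k \<inter> space M)"
      "?Y -` ?B \<inter> space M = (\<Inter>k\<in>J. Y k -` b k \<inter> space M)"
      using J X_space Y_space by (auto simp: subset_iff)
    have "prob (\<Inter>k\<in>J. (\<lambda>\<omega>. (X k \<omega>, Y k \<omega>)) -` (a k \<times> b k) \<inter> space M)
        = prob (\<Inter>k\<in>J. X k -` a k \<inter> space M) * prob (\<Inter>k\<in>J. Y k -` b k \<inter> space M)"
      using indep_varD[OF XY A B] by (simp only: eqs)
    then show ?thesis
      using indep_varsD[OF X J(1,3,2), of a] indep_varsD[OF Y J(1,3,2), of b] ab by simp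
  qed
  have "indep_sets ?R I"
  proof (rule indep_setsI)
    show "?R k \<subseteq> events" if "k \<in> I" for k
      using mX[OF that] mY[OF that] by (auto intro!: measurable_sets[OF measurable_Pair])
    fix A J assume J: "J \<noteq> {}" "J \<subseteq> I" "finite J" and "\<forall>j\<in>J. A j \<in> ?R j"
    then obtain a b where ab: "\<And>j. j \<in> J \<Longrightarrow> a j \<in> sets N \<and> b j \<in> sets N'"
      and A: "\<And>j. j \<in> J \<Longrightarrow> A j = (\<lambda>\<omega>. (X j \<omega>, Y j \<omega>)) -` (a j \<times> b j) \<inter> space M"
      by (simp add: mem_Collect_eq) metis
    have "prob (A j) = prob (X j -` a j \<inter> space M) * prob (Y j -` b j \<inter> space M)" if "j \<in> J" for j
      using prob_rect[of "{j}" a b] J ab A that by auto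
    moreover have "(\<Inter>j\<in>J. A j) = (\<Inter>k\<in>J. (\<lambda>\<omega>. (X k \<omega>, Y k \<omega>)) -` (a k \<times> b k) \<inter> space M)"
      by (intro INF_cong refl A)
    ultimately show "prob (\<Inter>j\<in>J. A j) = (\<Prod>j\<in>J. prob (A j))"
      using prob_rect[OF J ab] by (simp add: prod.distrib)
  qed
  moreover have "Int_stable (?R k)" for k
  proof (rule Int_stableI)
    fix C D assume "C \<in> ?R k" "D \<in> ?R k"
    then obtain A B A' B' where
      "C = (\<lambda>\<omega>. (X k \<omega>, Y k \<omega>)) -` (A \<times> B) \<inter> space M" "A \<in> sets N" "B \<in> sets N'"
      "D = (\<lambda>\<omega>. (X k \<omega>, Y k \<omega>)) -` (A' \<times> B') \<inter> space M" "A' \<in> sets N" "B' \<in> sets N'"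
      by blast
    then have "C \<inter> D = (\<lambda>\<omega>. (X k \<omega>, Y k \<omega>)) -` ((A \<inter> A') \<times> (B \<inter> B')) \<inter> space M"
      "A \<inter> A' \<in> sets N" "B \<inter> B' \<in> sets N'"
      by auto
    then show "C \<inter> D \<in> ?R k" by blast
  qed
  ultimately have "indep_sets (\<lambda>k. sigma_sets (space M) (?R k)) I"
    by (rule indep_sets_sigma)
  moreover have "{(\<lambda>\<omega>. (X k \<omega>, Y k \<omega>)) -` C \<inter> space M | C. C \<in> sets (N \<Otimes>\<^sub>M N')}
      \<subseteq> sigma_sets (space M) (?R k)" if "k \<in> I" for k
  proof -
    have "(\<lambda>\<omega>. (X k \<omega>, Y k \<omega>)) \<in> space M \<rightarrow> space N \<times> space N'"
      by (auto intro: measurable_space[OF mX[OF that]] measurable_space[OF mY[OF that]])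
    \<comment> \<open>Taking preimages commutes with generating a sigma-algebra, so preimages of
      product events are generated by preimages of rectangles.\<close>
    from sigma_sets_vimage_commute[OF this, of "{a \<times> b | a b. a \<in> sets N \<and> b \<in> sets N'}"]
    have "{(\<lambda>\<omega>. (X k \<omega>, Y k \<omega>)) -` C \<inter> space M | C. C \<in> sets (N \<Otimes>\<^sub>M N')}
      = sigma_sets (space M) {(\<lambda>\<omega>. (X k \<omega>, Y k \<omega>)) -` C \<inter> space M | C. C \<in> {a \<times> b | a b. a \<in> sets N \<and> b \<in> sets N'}}"
      by (simp only: sets_pair_measure)
    also have "\<dots> \<subseteq> sigma_sets (space M) (?R k)"
      by (rule sigma_sets_mono') blast
    finally show ?thesis .
  qed
  ultimately have "indep_sets (\<lambda>k. {(\<lambda>\<omega>. (X k \<omega>, Y k \<omega>)) -` C \<inter> space M | C. C \<in> sets (N \<Otimes>\<^sub>M N')}) I"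
    by (rule indep_sets_mono_sets)
  then show ?thesis
    unfolding indep_vars_def2 by (blast intro: measurable_Pair mX mY)
qed

section \<open>The matrix after link failures\<close>

definition link_failure :: "real ^ 'n ^ 'n \<Rightarrow> real ^ 'n ^ 'n \<Rightarrow> real ^ 'n ^ 'n" where
  "link_failure A B = A * (1 - B) + diag_matrix ((A * B) *v 1)"

text \<open>As one fixed function of the current pair of matrices, the failure model inherits
  measurability and independence over time by composition.\<close>

lemma failure_model_eq: "failure_model W F k \<omega> = link_failure (W k \<omega>) (F k \<omega>)"
  by (simp add: failure_model_def link_failure_def)

lemma link_failure_offdiag: "i \<noteq> j \<Longrightarrow> link_failure A B $ i $ j = (1 - B $ i $ j) * A $ i $ j"
  by (simp add: link_failure_def diag_matrix_def)

lemma link_failure_diag: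
  "link_failure A B $ i $ i = A $ i $ i * (1 - B $ i $ i) + (\<Sum>l\<in>UNIV. A $ i $ l * B $ i $ l)"
  by (simp add: link_failure_def diag_matrix_def matrix_vector_mult_def)

text \<open>Failed weights are moved to the diagonal. If the diagonal entry itself fails, the sum
  over the row returns it.\<close>

lemma link_failure_diag_ge:
  assumes "stochastic_matrix A" "\<And>i j. B $ i $ j \<in> {0, 1}"
  shows "A $ i $ i \<le> link_failure A B $ i $ i"
proof -
  have "A $ i $ l * B $ i $ l \<ge> 0" for l
    using assms(2)[of i l] stochastic_matrix_nonneg[OF assms(1), of i l] by auto
  then have "A $ i $ i * B $ i $ i \<le> (\<Sum>l\<in>UNIV. A $ i $ l * B $ i $ l)"
    by (intro member_le_sum) auto
  then show ?thesis by (simp add: link_failure_diag algebra_simps)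
qed

text \<open>What a row loses by failures is exactly what its diagonal entry receives.\<close>

lemma stochastic_link_failure:
  assumes st: "stochastic_matrix A" and B: "\<And>i j. B $ i $ j \<in> {0, 1}"
  shows "stochastic_matrix (link_failure A B)"
  unfolding stochastic_matrix_def
proof (intro conjI allI)
  note nn = stochastic_matrix_nonneg[OF st]
  fix i j
  show "0 \<le> link_failure A B $ i $ j"
  proof (cases "i = j")
    case True
    then show ?thesis
      using link_failure_diag_ge[OF st B, of j] nn[of j j] by simp
  next
    case False
    then show ?thesis
      using B[of i j] nn[of i j] by (auto simp: link_failure_offdiag)
  qed
  have "link_failure A B $ i $ j = A $ i $ j * (1 - B $ i $ j)
      + (if i = j then \<Sum>l\<in>UNIV. A $ i $ l * B $ i $ l else 0)" for j
    by (simp add: link_failure_offdiag link_failure_diag)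
  then have "(\<Sum>j\<in>UNIV. link_failure A B $ i $ j)
      = (\<Sum>j\<in>UNIV. A $ i $ j * (1 - B $ i $ j)) + (\<Sum>l\<in>UNIV. A $ i $ l * B $ i $ l)"
    by (simp add: sum.distrib)
  also have "\<dots> = (\<Sum>j\<in>UNIV. A $ i $ j)"
    by (simp add: right_diff_distrib sum_subtractf)
  finally show "(\<Sum>j\<in>UNIV. link_failure A B $ i $ j) = 1"
    using st by (simp add: stochastic_matrix_def)
qed

lemma borel_measurable_link_failure:
  "(\<lambda>p. link_failure (fst p) (snd p)) \<in> borel_measurable (borel :: ((real^'n^'n) \<times> (real^'n^'n)) measure)"
proof (rule borel_measurable_continuous_onI)
  have "link_failure A B = (\<chi> i j. A $ i $ j * (1 - B $ i $ j)
      + (if i = j then \<Sum>l\<in>UNIV. A $ i $ l * B $ i $ l else 0))" for A B :: "real^'n^'n"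
    by (simp add: vec_eq_iff link_failure_def diag_matrix_def matrix_vector_mult_def)
  moreover have "continuous_on UNIV (\<lambda>p :: (real^'n^'n) \<times> (real^'n^'n).
      if i = j then \<Sum>l\<in>UNIV. fst p $ i $ l * snd p $ i $ l else 0)" for i j
    by (cases "i = j") (auto intro!: continuous_intros)
  ultimately show "continuous_on UNIV (\<lambda>p :: (real^'n^'n) \<times> (real^'n^'n). link_failure (fst p) (snd p))"
    by (auto intro!: continuous_intros)
qed

lemma norm_stochastic_matrix_le:
  fixes A :: "real ^ 'n ^ 'n"
  assumes "stochastic_matrix A"
  shows "norm A \<le> real CARD('n)"
proof -
  have "norm A \<le> (\<Sum>i\<in>UNIV. norm (A $ i))"
    unfolding norm_vec_def by (rule L2_set_le_sum) simp
  also have "\<dots> \<le> (\<Sum>i\<in>(UNIV::'n set). 1)"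
  proof (intro sum_mono)
    fix i
    have "norm (A $ i) \<le> (\<Sum>j\<in>UNIV. \<bar>A $ i $ j\<bar>)" by (rule norm_le_l1_cart)
    also have "\<dots> = 1" using assms by (simp add: stochastic_matrix_def)
    finally show "norm (A $ i) \<le> 1" .
  qed
  finally show ?thesis by simp
qed

text \<open>The steady state is defined by a matrix-valued integral. The norm bound makes it exist,
  and taking an entry is bounded linear, hence commutes with it.\<close>

lemma (in independent_chain) expectation_U_nth:
  "expectation (U k) $ i $ j = expectation (\<lambda>\<omega>. U k \<omega> $ i $ j)"
proof -
  have "integrable M (U k)"
    by (rule integrable_bounded_on_space[OF _ norm_stochastic_matrix_le[OF stochastic_U]]) simp
  moreover have "bounded_linear (\<lambda>A :: real^'n^'n. A $ i $ j)"
    by (rule bounded_linear_compose[OF bounded_linear_vec_nth bounded_linear_vec_nth])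
  ultimately show ?thesis
    using integral_bounded_linear by fastforce
qed

section \<open>Transfer of the hypotheses from \<open>W\<close> to the failure model\<close>

theorem lemma6:
  fixes M :: "'a measure"
    and W F :: "nat \<Rightarrow> 'a \<Rightarrow> real ^ 'n ^ 'n"
    and \<pi> :: "real ^ 'n"
    and p :: "nat \<Rightarrow> real"
  assumes "prob_space M"
    and "independent_random_model M W"
    and "common_steady_state M W \<pi>" and "\<forall>i. \<pi> $ i > 0"
    and "feedback_property M W"
    and "uniform_link_failure M F"
    and "independent_processes M W F"
    and "\<And>k i j. i \<noteq> j \<Longrightarrow> p k = measure M {\<omega> \<in> space M. F k \<omega> $ i $ j = 1}"
  shows "ergodic_model M (failure_model W F) \<longleftrightarrow>
    (\<forall>S. S \<noteq> {} \<and> S \<noteq> UNIV \<longrightarrow>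
      filterlim (\<lambda>n. \<Sum>k<n. (1 - p k) * (\<integral>\<omega>. flow S (W k \<omega>) \<partial>M)) at_top sequentially)"
proof -
  interpret prob_space M by fact
  interpret W: independent_chain M W by unfold_locales fact
  let ?U = "failure_model W F"
  have [measurable]: "F k \<in> borel_measurable M" for k
    using assms(6) by (simp add: uniform_link_failure_def)
  have F01: "\<omega> \<in> space M \<Longrightarrow> F k \<omega> $ i $ j \<in> {0, 1}" for k \<omega> i j
    using assms(6) by (simp add: uniform_link_failure_def)
  have indF: "indep_vars (\<lambda>_. borel) F UNIV"
    using assms(6) by (simp add: uniform_link_failure_def)
  have WF: "indep_var (\<Pi>\<^sub>M k\<in>UNIV. borel) (\<lambda>\<omega> k. W k \<omega>) (\<Pi>\<^sub>M k\<in>UNIV. borel) (\<lambda>\<omega> k. F k \<omega>)"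
    using assms(7) by (simp add: independent_processes_def)
  \<comment> \<open>The Borel sets of the product space are the product of the Borel sets, so the
    pairing lemma fits the measurability of \<open>link_failure\<close>.\<close>
  have "indep_vars (\<lambda>_. borel) (\<lambda>k \<omega>. (W k \<omega>, F k \<omega>)) UNIV"
    using indep_vars_Pair[OF W.indep_U indF] WF by (simp add: borel_prod restrict_def)
  from indep_vars_compose2[OF this borel_measurable_link_failure]
  have indU: "indep_vars (\<lambda>_. borel) ?U UNIV"
    by (simp add: failure_model_eq[abs_def])
  have "random_model M ?U"
    unfolding random_model_def
  proof (intro conjI allI ballI)
    show "?U k \<in> borel_measurable M" for k
      using indU unfolding indep_vars_def2 by blast
    show "stochastic_matrix (?U k \<omega>)" if "\<omega> \<in> space M" for k \<omega>
      unfolding failure_model_eq by (intro stochastic_link_failure W.stochastic_U F01 that)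
  qed
  with indU interpret U: independent_chain M ?U
    by unfold_locales (simp add: independent_random_model_def)
  \<comment> \<open>Stated for any integrable function of \<open>W k\<close>, since it is needed for
    single entries and for the products in the feedback property.\<close>
  have expect: "expectation (\<lambda>\<omega>. (1 - F k \<omega> $ i $ j) * f (W k \<omega>)) = (1 - p k) * expectation (\<lambda>\<omega>. f (W k \<omega>))"
    and int: "integrable M (\<lambda>\<omega>. (1 - F k \<omega> $ i $ j) * f (W k \<omega>))"
    if [measurable]: "f \<in> borel_measurable borel" and f: "integrable M (\<lambda>\<omega>. f (W k \<omega>))" and "i \<noteq> j"
    for f and i j k
  proof -
    have "indep_var borel ((\<lambda>z. f (z k)) \<circ> (\<lambda>\<omega> k. W k \<omega>)) borel ((\<lambda>z. 1 - z k $ i $ j) \<circ> (\<lambda>\<omega> k. F k \<omega>))"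
      by (rule indep_var_compose[OF WF]) measurable
    then have ind: "indep_var borel (\<lambda>\<omega>. f (W k \<omega>)) borel (\<lambda>\<omega>. 1 - F k \<omega> $ i $ j)"
      by (simp add: comp_def)
    let ?E = "{\<omega> \<in> space M. F k \<omega> $ i $ j = 1}"
    have intF: "integrable M (\<lambda>\<omega>. F k \<omega> $ i $ j)"
    proof (rule integrable_bounded_on_space[where B = 1])
      show "norm (F k \<omega> $ i $ j) \<le> 1" if "\<omega> \<in> space M" for \<omega>
        using F01[OF that, of k i j] by auto
    qed measurable
    have "expectation (\<lambda>\<omega>. F k \<omega> $ i $ j) = expectation (indicator ?E)"
    proof (intro Bochner_Integration.integral_cong refl)
      show "F k \<omega> $ i $ j = indicator ?E \<omega>" if "\<omega> \<in> space M" for \<omega>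
        using F01[OF that, of k i j] that by (auto simp: indicator_def)
    qed
    also have "\<dots> = p k"
      using assms(8)[OF \<open>i \<noteq> j\<close>, of k] by simp
    finally have 1: "expectation (\<lambda>\<omega>. 1 - F k \<omega> $ i $ j) = 1 - p k"
      using intF by (simp add: prob_space)
    have intF1: "integrable M (\<lambda>\<omega>. 1 - F k \<omega> $ i $ j)"
      using intF by simp
    show "expectation (\<lambda>\<omega>. (1 - F k \<omega> $ i $ j) * f (W k \<omega>)) = (1 - p k) * expectation (\<lambda>\<omega>. f (W k \<omega>))"
      using indep_var_lebesgue_integral[OF ind f intF1] by (simp add: 1 mult.commute)
    show "integrable M (\<lambda>\<omega>. (1 - F k \<omega> $ i $ j) * f (W k \<omega>))"
      using indep_var_integrable[OF ind f intF1] by (simp add: mult.commute)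
  qed
  have offdiag: "expectation (\<lambda>\<omega>. ?U k \<omega> $ i $ j) = (1 - p k) * expectation (\<lambda>\<omega>. W k \<omega> $ i $ j)"
    if "i \<noteq> j" for k i j
    using expect[of "\<lambda>A. A $ i $ j" k i j] that
    by (simp add: failure_model_eq link_failure_offdiag W.integrable_U_nth)
  have flow: "expectation (\<lambda>\<omega>. flow S (?U k \<omega>)) = (1 - p k) * expectation (\<lambda>\<omega>. flow S (W k \<omega>))" for S k
  proof -
    have "expectation (\<lambda>\<omega>. flow S (?U k \<omega>))
        = (\<Sum>i\<in>S. \<Sum>j\<in>-S. expectation (\<lambda>\<omega>. ?U k \<omega> $ i $ j) + expectation (\<lambda>\<omega>. ?U k \<omega> $ j $ i))"
      by (simp add: flow_def U.integrable_U_nth)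
    also have "\<dots> = (\<Sum>i\<in>S. \<Sum>j\<in>-S. (1 - p k) * (expectation (\<lambda>\<omega>. W k \<omega> $ i $ j) + expectation (\<lambda>\<omega>. W k \<omega> $ j $ i)))"
    proof (intro sum.cong refl)
      fix i j assume "i \<in> S" "j \<in> - S"
      then have "i \<noteq> j" by blast
      then show "expectation (\<lambda>\<omega>. ?U k \<omega> $ i $ j) + expectation (\<lambda>\<omega>. ?U k \<omega> $ j $ i)
          = (1 - p k) * (expectation (\<lambda>\<omega>. W k \<omega> $ i $ j) + expectation (\<lambda>\<omega>. W k \<omega> $ j $ i))"
        using offdiag[of i j k] offdiag[of j i k] by (simp add: distrib_left)
    qed
    also have "\<dots> = (1 - p k) * expectation (\<lambda>\<omega>. flow S (W k \<omega>))"
      by (simp add: flow_def W.integrable_U_nth sum_distrib_left)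
    finally show ?thesis .
  qed
  have row: "(\<Sum>j\<in>UNIV. expectation (\<lambda>\<omega>. V \<omega> $ i $ j)) = 1"
    if V: "\<And>j. integrable M (\<lambda>\<omega>. V \<omega> $ i $ j)" "\<And>\<omega>. \<omega> \<in> space M \<Longrightarrow> stochastic_matrix (V \<omega>)"
    for V :: "'a \<Rightarrow> real^'n^'n" and i
  proof -
    have "(\<Sum>j\<in>UNIV. expectation (\<lambda>\<omega>. V \<omega> $ i $ j)) = expectation (\<lambda>\<omega>. \<Sum>j\<in>UNIV. V \<omega> $ i $ j)"
      using V by simp
    also have "\<dots> = expectation (\<lambda>\<omega>. 1)"
      using V(2) by (intro Bochner_Integration.integral_cong refl) (simp add: stochastic_matrix_def)
    finally show ?thesis by (simp add: prob_space)
  qed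
  \<comment> \<open>In matrix form, the expectation of the failure model is \<open>1 - p k\<close>
    times that of \<open>W k\<close> plus \<open>p k\<close> times the identity. The diagonal
    follows from the other entries of the row, as the rows of both expectations sum to 1. Every left
    fixed vector is therefore kept.\<close>
  have entry: "expectation (\<lambda>\<omega>. ?U k \<omega> $ i $ j)
      = (1 - p k) * expectation (\<lambda>\<omega>. W k \<omega> $ i $ j) + (if i = j then p k else 0)" for k i j
  proof (cases "i = j")
    case True
    let ?R = "\<lambda>V. \<Sum>j\<in>UNIV - {i}. expectation (\<lambda>\<omega>. V k \<omega> $ i $ j)"
    have RU: "?R ?U = 1 - expectation (\<lambda>\<omega>. ?U k \<omega> $ i $ i)"
      using row[of "?U k" i] U.integrable_U_nth U.stochastic_U by (simp add: sum.remove[of _ i])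
    have RW: "?R W = 1 - expectation (\<lambda>\<omega>. W k \<omega> $ i $ i)"
      using row[of "W k" i] W.integrable_U_nth W.stochastic_U by (simp add: sum.remove[of _ i])
    have "?R ?U = (1 - p k) * ?R W"
      unfolding sum_distrib_left
    proof (intro sum.cong refl)
      fix j assume "j \<in> UNIV - {i}"
      then have "i \<noteq> j" by blast
      then show "expectation (\<lambda>\<omega>. ?U k \<omega> $ i $ j) = (1 - p k) * expectation (\<lambda>\<omega>. W k \<omega> $ i $ j)"
        by (rule offdiag)
    qed
    then have "1 - expectation (\<lambda>\<omega>. ?U k \<omega> $ i $ i)
        = (1 - p k) * (1 - expectation (\<lambda>\<omega>. W k \<omega> $ i $ i))"
      unfolding RU RW .
    then show ?thesis using True by (simp add: algebra_simps)
  qed (simp add: offdiag)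
  from assms(5) obtain \<gamma> where \<gamma>: "\<gamma> > 0"
    and fb: "\<And>k i j. i \<noteq> j \<Longrightarrow> \<gamma> * expectation (\<lambda>\<omega>. W k \<omega> $ i $ j + W k \<omega> $ j $ i)
        \<le> expectation (\<lambda>\<omega>. W k \<omega> $ i $ i * W k \<omega> $ i $ j + W k \<omega> $ j $ j * W k \<omega> $ j $ i)"
    unfolding feedback_property_def by blast
  interpret U: balanced_chain M ?U \<pi> \<gamma>
  proof
    show "0 < \<pi> $ i" for i using assms(4) by blast
    show "0 < \<gamma>" by fact
    show "(\<Sum>l\<in>UNIV. \<pi> $ l * expectation (\<lambda>\<omega>. ?U k \<omega> $ l $ j)) = \<pi> $ j" for k j
    proof -
      have "(\<Sum>l\<in>UNIV. \<pi> $ l * expectation (\<lambda>\<omega>. W k \<omega> $ l $ j)) = (\<pi> v* expectation (W k)) $ j"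
        by (simp add: vector_matrix_mult_def W.expectation_U_nth mult.commute)
      also have "\<dots> = \<pi> $ j"
        using assms(3) by (simp add: common_steady_state_def)
      finally have W: "(\<Sum>l\<in>UNIV. \<pi> $ l * expectation (\<lambda>\<omega>. W k \<omega> $ l $ j)) = \<pi> $ j" .
      have "(\<Sum>l\<in>UNIV. \<pi> $ l * expectation (\<lambda>\<omega>. ?U k \<omega> $ l $ j))
          = (\<Sum>l\<in>UNIV. (1 - p k) * (\<pi> $ l * expectation (\<lambda>\<omega>. W k \<omega> $ l $ j)) + (if l = j then p k * \<pi> $ l else 0))"
        unfolding entry by (intro sum.cong refl) (simp add: algebra_simps)
      also have "\<dots> = (1 - p k) * \<pi> $ j + p k * \<pi> $ j"
        by (simp add: sum.distrib W flip: sum_distrib_left)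
      finally show ?thesis by (simp add: algebra_simps)
    qed
    show "\<gamma> * expectation (\<lambda>\<omega>. ?U k \<omega> $ i $ j + ?U k \<omega> $ j $ i)
        \<le> expectation (\<lambda>\<omega>. ?U k \<omega> $ i $ i * ?U k \<omega> $ i $ j + ?U k \<omega> $ j $ j * ?U k \<omega> $ j $ i)"
      if "i \<noteq> j" for k i j
    proof -
      have p1: "0 \<le> 1 - p k" using assms(8)[OF that, of k] by simp
      \<comment> \<open>Failures do not lower the diagonal, so it may be replaced by that of
        \<open>W k\<close>. What remains has the single failure factor
        \<open>1 - F k \<omega> $ i $ j\<close>, which splits off in expectation.\<close>
      have le: "(1 - p k) * expectation (\<lambda>\<omega>. W k \<omega> $ i $ i * W k \<omega> $ i $ j)
          \<le> expectation (\<lambda>\<omega>. ?U k \<omega> $ i $ i * ?U k \<omega> $ i $ j)" if "i \<noteq> j" for i j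
      proof -
        have "(1 - p k) * expectation (\<lambda>\<omega>. W k \<omega> $ i $ i * W k \<omega> $ i $ j)
            = expectation (\<lambda>\<omega>. (1 - F k \<omega> $ i $ j) * (W k \<omega> $ i $ i * W k \<omega> $ i $ j))"
          by (rule expect[symmetric, OF _ W.integrable_U_nth_mult that]) measurable
        also have "\<dots> \<le> expectation (\<lambda>\<omega>. ?U k \<omega> $ i $ i * ?U k \<omega> $ i $ j)"
        proof (rule integral_mono)
          show "integrable M (\<lambda>\<omega>. (1 - F k \<omega> $ i $ j) * (W k \<omega> $ i $ i * W k \<omega> $ i $ j))"
            by (rule int[OF _ W.integrable_U_nth_mult that]) measurable
          show "integrable M (\<lambda>\<omega>. ?U k \<omega> $ i $ i * ?U k \<omega> $ i $ j)"
            by (rule U.integrable_U_nth_mult)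
          fix \<omega> assume \<omega>: "\<omega> \<in> space M"
          have "W k \<omega> $ i $ i \<le> ?U k \<omega> $ i $ i"
            unfolding failure_model_eq by (intro link_failure_diag_ge W.stochastic_U F01 \<omega>)
          then have "W k \<omega> $ i $ i * ?U k \<omega> $ i $ j \<le> ?U k \<omega> $ i $ i * ?U k \<omega> $ i $ j"
            by (intro mult_right_mono U.U_nth_bounds \<omega>)
          then show "(1 - F k \<omega> $ i $ j) * (W k \<omega> $ i $ i * W k \<omega> $ i $ j) \<le> ?U k \<omega> $ i $ i * ?U k \<omega> $ i $ j"
            using that by (simp add: failure_model_eq link_failure_offdiag mult_ac)
        qed
        finally show ?thesis .
      qed
      \<comment> \<open>Both sides of the feedback inequality for \<open>W\<close> are scaled by the
        same \<open>1 - p k\<close>, so the constant \<open>\<gamma>\<close> is unchanged.\<close>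
      have "\<gamma> * expectation (\<lambda>\<omega>. ?U k \<omega> $ i $ j + ?U k \<omega> $ j $ i)
          = (1 - p k) * (\<gamma> * expectation (\<lambda>\<omega>. W k \<omega> $ i $ j + W k \<omega> $ j $ i))"
        using that by (simp add: U.integrable_U_nth W.integrable_U_nth offdiag algebra_simps)
      also have "\<dots> \<le> (1 - p k) * expectation (\<lambda>\<omega>. W k \<omega> $ i $ i * W k \<omega> $ i $ j + W k \<omega> $ j $ j * W k \<omega> $ j $ i)"
        by (intro mult_left_mono fb that p1)
      also have "\<dots> \<le> expectation (\<lambda>\<omega>. ?U k \<omega> $ i $ i * ?U k \<omega> $ i $ j + ?U k \<omega> $ j $ j * ?U k \<omega> $ j $ i)"
        using le[OF that] le[OF that[symmetric]]
        by (simp add: U.integrable_U_nth_mult W.integrable_U_nth_mult distrib_left)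
      finally show ?thesis .
    qed
  qed
  have "filterlim (\<lambda>n. \<Sum>k<n. (1 - p k) * (\<integral>\<omega>. flow S (W k \<omega>) \<partial>M)) at_top sequentially
      \<longleftrightarrow> \<not> summable (\<lambda>k. expectation (\<lambda>\<omega>. flow S (?U k \<omega>)))" for S
    unfolding flow[symmetric]
    by (intro filterlim_sum_at_top_iff integral_nonneg_AE AE_I2 flow_nonneg U.stochastic_U)
  then show ?thesis
    by (simp add: U.ergodic_iff_infinite_expected_flow)
qed

end
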